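(* Let $X$ be an $S$-scheme and $n\ge 1$. The symmetric group $S_{n+1}$ (permutations of $\{0,\dots,n\}$), acting on $\Psi^{(n)}_{X/S}$ by $(\sigma f)(x_0,\dots,x_n)=f(x_{\sigma(0)},\dots,x_{\sigma(n)})$, acts via the sign character: $\sigma f=\mathrm{sgn}(\sigma)\,f$ for all $\sigma\in S_{n+1}$ and $f\in\Psi^{(n)}_{X/S}$.
   Context: All constructions are Zariski local on $X$ and $S$, and $X/S$ is taken to be separated; $\mathcal{O}_X^{\otimes n+1}$ is the tensor power over $\mathcal{O}_S$. For $0\le r,s\le n$, $J_{rs}\subset\mathcal{O}_X^{\otimes n+1}$ is the ideal generated by the elements $d^{r,s}b:=$ (tensor with $b$ in position $s+1$, $1$ elsewhere) $-$ (tensor with $b$ in position $r+1$, $1$ elsewhere), $b\in\mathcal{O}_X$. Put $J^{(2)}_{0n}:=\sum_{r<s}J_{rs}^2$ and $\Delta^{(n)}_{X/S}:=\mathrm{Spec}(\mathcal{O}_X^{\otimes n+1}/J^{(2)}_{0n})$, a closed subscheme of $X^{n+1}$ (fibre power over $S$) whose $T$-points are $(n+1)$-tuples $(x_0,\dots,x_n)$ of $T$-points of $X$ which are pairwise infinitesimally close to first order. $\Psi^{(n)}_{X/S}:=\bigcap_{0\le r<s\le n}\tilde J_{rs}$, where $\tilde J_{rs}$ is the image of $J_{rs}$ in $\mathcal{O}_X^{\otimes n+1}/J^{(2)}_{0n}$; equivalently, it is the ideal of functions $f(x_0,\dots,x_n)$ on $\Delta^{(n)}_{X/S}$ which vanish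 whenever $x_r=x_s$ for some pair $r<s$. *)

theory Defs
  imports
    "HOL-Algebra.Ideal_Product"
    "HOL-Algebra.QuotRing"
    "HOL-Analysis.Abstract_Topology"
    "HOL-Combinatorics.Permutations"
    "HOL-Library.Poly_Mapping"
begin

section \<open>Schemes and their morphisms\<close>

record ('x, 'r) ringed_space =
  pts :: "'x topology"
  sec :: "'x set \<Rightarrow> 'r ring"
  res :: "'x set \<Rightarrow> 'x set \<Rightarrow> 'r \<Rightarrow> 'r"  \<comment> \<open>\<^term>\<open>res X U V\<close> restricts sections from \<^term>\<open>U\<close> to \<^term>\<open>V \<subseteq> U\<close>\<close>

locale ringed_space =
  fixes X :: "('x, 'r) ringed_space"
  assumes sec_cring: "openin (pts X) U \<Longrightarrow> cring (sec X U)"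
    and res_hom: "\<lbrakk>openin (pts X) U; openin (pts X) V; V \<subseteq> U\<rbrakk>
      \<Longrightarrow> res X U V \<in> ring_hom (sec X U) (sec X V)"
    and res_id: "\<lbrakk>openin (pts X) U; s \<in> carrier (sec X U)\<rbrakk> \<Longrightarrow> res X U U s = s"
    and res_comp: "\<lbrakk>openin (pts X) U; openin (pts X) V; openin (pts X) W; W \<subseteq> V; V \<subseteq> U;
        s \<in> carrier (sec X U)\<rbrakk> \<Longrightarrow> res X V W (res X U V s) = res X U W s"
    and locality: "\<lbrakk>\<And>U. U \<in> \<U> \<Longrightarrow> openin (pts X) U;
        s \<in> carrier (sec X (\<Union>\<U>)); t \<in> carrier (sec X (\<Union>\<U>));
        \<And>U. U \<in> \<U> \<Longrightarrow> res X (\<Union>\<U>) U s = res X (\<Union>\<U>) U t\<rbrakk> \<Longrightarrow> s = t"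
    and gluing: "\<lbrakk>\<And>U. U \<in> \<U> \<Longrightarrow> openin (pts X) U;
        \<And>U. U \<in> \<U> \<Longrightarrow> fam U \<in> carrier (sec X U);
        \<And>U V. \<lbrakk>U \<in> \<U>; V \<in> \<U>\<rbrakk> \<Longrightarrow> res X U (U \<inter> V) (fam U) = res X V (U \<inter> V) (fam V)\<rbrakk>
      \<Longrightarrow> \<exists>t \<in> carrier (sec X (\<Union>\<U>)). \<forall>U \<in> \<U>. res X (\<Union>\<U>) U t = fam U"

definition zariski :: "('r, 'm) ring_scheme \<Rightarrow> 'r set topology" where
  "zariski R = topology_generated_by ((\<lambda>f. {p. primeideal p R \<and> f \<notin> p}) ` carrier R)"

text \<open>\<^term>\<open>\<rho>\<close> exhibits \<^term>\<open>R'\<close> as the localization of \<^term>\<open>R\<close> at the powers of \<^term>\<open>f\<close>.\<close>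

definition localization_at ::
  "('r, 'm) ring_scheme \<Rightarrow> 'r \<Rightarrow> ('q, 'k) ring_scheme \<Rightarrow> ('r \<Rightarrow> 'q) \<Rightarrow> bool" where
  "localization_at R f R' \<rho> \<longleftrightarrow>
     \<rho> \<in> ring_hom R R' \<and> \<rho> f \<in> Units R' \<and>
     (\<forall>y \<in> carrier R'. \<exists>a \<in> carrier R. \<exists>k::nat. y \<otimes>\<^bsub>R'\<^esub> (\<rho> f [^]\<^bsub>R'\<^esub> k) = \<rho> a) \<and>
     (\<forall>a \<in> carrier R. \<rho> a = \<zero>\<^bsub>R'\<^esub> \<longrightarrow> (\<exists>k::nat. (f [^]\<^bsub>R\<^esub> k) \<otimes>\<^bsub>R\<^esub> a = \<zero>\<^bsub>R\<^esub>))"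

text \<open>
  The structure sheaf of \<open>Spec R\<close> is the sheaf whose sections over a basic open set \<open>D(f)\<close> are the
  localization \<open>R\<^sub>f\<close>. So an open \<open>U\<close> is affine iff \<open>U\<close> is homeomorphic to \<open>Spec R\<close>, with
  \<open>R = \<O>(U)\<close>, in such a way that the sections over the preimage of every \<open>D(f)\<close> are \<open>R\<^sub>f\<close> through
  the restriction map.
\<close>

definition affine_open :: "('x, 'r) ringed_space \<Rightarrow> 'x set \<Rightarrow> bool" where
  "affine_open X U \<longleftrightarrow> openin (pts X) U \<and>
     (\<exists>h. homeomorphic_map (subtopology (pts X) U) (zariski (sec X U)) h \<and>
          (\<forall>f \<in> carrier (sec X U).
             localization_at (sec X U) f (sec X {x \<in> U. f \<notin> h x}) (res X U {x \<in> U. f \<notin> h x})))"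

locale scheme = ringed_space X for X :: "('x, 'r) ringed_space" +
  assumes affine_cover: "x \<in> topspace (pts X) \<Longrightarrow> \<exists>U. x \<in> U \<and> affine_open X U"

text \<open>The germ of \<^term>\<open>s \<in> carrier (sec X U)\<close> at \<^term>\<open>x \<in> U\<close> is a unit of the stalk.\<close>

definition germ_unit :: "('x, 'r) ringed_space \<Rightarrow> 'x set \<Rightarrow> 'r \<Rightarrow> 'x \<Rightarrow> bool" where
  "germ_unit X U s x \<longleftrightarrow>
     (\<exists>W. openin (pts X) W \<and> x \<in> W \<and> W \<subseteq> U \<and> res X U W s \<in> Units (sec X W))"

record ('x, 'r, 's, 'a) space_map =
  pt :: "'x \<Rightarrow> 's"
  comor :: "'s set \<Rightarrow> 'a \<Rightarrow> 'r"

definition preim :: "('x, 'r) ringed_space \<Rightarrow> ('x, 'r, 's, 'a) space_map \<Rightarrow> 's set \<Rightarrow> 'x set" where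
  "preim X \<phi> V = {x \<in> topspace (pts X). pt \<phi> x \<in> V}"

text \<open>An \<open>S\<close>-scheme \<open>X\<close> with structure morphism \<open>\<phi>\<close>; the last assumption says that the maps on
  stalks are local.\<close>

locale scheme_over = X: scheme X + S: scheme S
  for X :: "('x, 'r) ringed_space" and S :: "('s, 'a) ringed_space"
    and \<phi> :: "('x, 'r, 's, 'a) space_map" +
  assumes cont: "continuous_map (pts X) (pts S) (pt \<phi>)"
    and comor_hom: "openin (pts S) V \<Longrightarrow> comor \<phi> V \<in> ring_hom (sec S V) (sec X (preim X \<phi> V))"
    and comor_res: "\<lbrakk>openin (pts S) V; openin (pts S) V'; V' \<subseteq> V; a \<in> carrier (sec S V)\<rbrakk>
      \<Longrightarrow> comor \<phi> V' (res S V V' a) = res X (preim X \<phi> V) (preim X \<phi> V') (comor \<phi> V a)"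
    and comor_local: "\<lbrakk>openin (pts S) V; a \<in> carrier (sec S V); x \<in> preim X \<phi> V;
        germ_unit X (preim X \<phi> V) (comor \<phi> V a) x\<rbrakk> \<Longrightarrow> germ_unit S V a (pt \<phi> x)"


section \<open>Tensor powers over a base ring\<close>

text \<open>
  For \<open>g : A \<rightarrow> B\<close>, the ring \<open>B \<otimes>\<^sub>A \<dots> \<otimes>\<^sub>A B\<close> with factors numbered \<open>0, \<dots>, n\<close> is the quotient
  of the free abelian group on \<open>B\<close>-valued tuples, with multiplication extending the componentwise
  one bilinearly, by additivity in each entry and by moving scalars of \<open>A\<close> between entries.
  The class of the basis element \<open>b\<close> is \<open>b\<^sub>0 \<otimes> \<dots> \<otimes> b\<^sub>n\<close>. The relations are stable under
  multiplication by basis elements, so the ideal and the subgroup generated by them agree.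
\<close>

type_synonym 'r tfree = "(nat \<Rightarrow> 'r) \<Rightarrow>\<^sub>0 int"

definition tuples :: "nat \<Rightarrow> ('r, 'm) ring_scheme \<Rightarrow> (nat \<Rightarrow> 'r) set" where
  "tuples n B = ({0..n} \<rightarrow>\<^sub>E carrier B)"

abbreviation pure :: "(nat \<Rightarrow> 'r) \<Rightarrow> 'r tfree" where
  "pure b \<equiv> Poly_Mapping.single b 1"

definition free_ring :: "nat \<Rightarrow> ('r, 'm) ring_scheme \<Rightarrow> 'r tfree ring" where
  "free_ring n B =
    \<lparr>carrier = {F. Poly_Mapping.keys F \<subseteq> tuples n B},
     monoid.mult = (\<lambda>F G. \<Sum>b\<in>Poly_Mapping.keys F. \<Sum>c\<in>Poly_Mapping.keys G.
               Poly_Mapping.single (\<lambda>i\<in>{0..n}. b i \<otimes>\<^bsub>B\<^esub> c i)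
                 (Poly_Mapping.lookup F b * Poly_Mapping.lookup G c)),
     one = pure (\<lambda>i\<in>{0..n}. \<one>\<^bsub>B\<^esub>),
     zero = 0,
     add = (+)\<rparr>"

definition tensor_rel ::
  "nat \<Rightarrow> ('a, 'k) ring_scheme \<Rightarrow> ('r, 'm) ring_scheme \<Rightarrow> ('a \<Rightarrow> 'r) \<Rightarrow> 'r tfree set" where
  "tensor_rel n A B g =
     {pure (u(i := b \<oplus>\<^bsub>B\<^esub> c)) - pure (u(i := b)) - pure (u(i := c)) | u i b c.
        u \<in> tuples n B \<and> i \<le> n \<and> b \<in> carrier B \<and> c \<in> carrier B} \<union>
     {pure (u(i := g a \<otimes>\<^bsub>B\<^esub> u i)) - pure (u(j := g a \<otimes>\<^bsub>B\<^esub> u j)) | u i j a.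
        u \<in> tuples n B \<and> i \<le> n \<and> j \<le> n \<and> a \<in> carrier A}"

definition tensor_ideal ::
  "nat \<Rightarrow> ('a, 'k) ring_scheme \<Rightarrow> ('r, 'm) ring_scheme \<Rightarrow> ('a \<Rightarrow> 'r) \<Rightarrow> 'r tfree set" where
  "tensor_ideal n A B g = Idl\<^bsub>free_ring n B\<^esub> (tensor_rel n A B g)"

definition tensor_power ::
  "nat \<Rightarrow> ('a, 'k) ring_scheme \<Rightarrow> ('r, 'm) ring_scheme \<Rightarrow> ('a \<Rightarrow> 'r) \<Rightarrow> 'r tfree set ring" where
  "tensor_power n A B g = free_ring n B Quot tensor_ideal n A B g"

text \<open>Linear extension of a map between tuples, and the map of quotient rings
  \<open>_ / I \<rightarrow> R / J\<close> induced by a map \<open>h\<close> into \<open>R\<close> with \<open>h(I) \<subseteq> J\<close>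
  (all the cosets in the union then coincide).\<close>

definition lin_ext :: "((nat \<Rightarrow> 'r) \<Rightarrow> (nat \<Rightarrow> 'q)) \<Rightarrow> 'r tfree \<Rightarrow> 'q tfree" where
  "lin_ext h F = (\<Sum>b\<in>Poly_Mapping.keys F. Poly_Mapping.single (h b) (Poly_Mapping.lookup F b))"

definition quot_map :: "('q, 'm) ring_scheme \<Rightarrow> 'q set \<Rightarrow> ('p \<Rightarrow> 'q) \<Rightarrow> 'p set \<Rightarrow> 'q set" where
  "quot_map R J h C = (\<Union>x\<in>C. J +>\<^bsub>R\<^esub> h x)"


section \<open>Infinitesimal simplices over a pair of affine opens\<close>

text \<open>The element \<open>1 \<otimes> \<dots> \<otimes> b \<otimes> \<dots> \<otimes> 1\<close> with \<open>b\<close> as factor number \<open>i\<close>, i.e. the function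
  \<open>b(x\<^sub>i)\<close> (it is the tensor with \<open>b\<close> in position \<open>i + 1\<close>, counting positions from 1).\<close>

definition ins where
  "ins n A B g i b =
     tensor_ideal n A B g +>\<^bsub>free_ring n B\<^esub> pure ((\<lambda>j\<in>{0..n}. \<one>\<^bsub>B\<^esub>)(i := b))"

definition d_elem where
  "d_elem n A B g r s b = ins n A B g s b \<ominus>\<^bsub>tensor_power n A B g\<^esub> ins n A B g r b"

definition J_ideal where
  "J_ideal n A B g r s = Idl\<^bsub>tensor_power n A B g\<^esub> (d_elem n A B g r s ` carrier B)"

text \<open>The sum of a family of ideals is the ideal generated by their union.\<close>

definition J2_ideal where
  "J2_ideal n A B g =
     Idl\<^bsub>tensor_power n A B g\<^esub>
       (\<Union>(r, s) \<in> {(r, s). r < s \<and> s \<le> n}.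
          J_ideal n A B g r s \<cdot>\<^bsub>tensor_power n A B g\<^esub> J_ideal n A B g r s)"

definition Delta_ring where
  "Delta_ring n A B g = tensor_power n A B g Quot J2_ideal n A B g"

definition J_tilde where
  "J_tilde n A B g r s =
     (\<lambda>t. J2_ideal n A B g +>\<^bsub>tensor_power n A B g\<^esub> t) ` J_ideal n A B g r s"

definition Psi_ideal where
  "Psi_ideal n A B g =
     {f \<in> carrier (Delta_ring n A B g). \<forall>r s. r < s \<and> s \<le> n \<longrightarrow> f \<in> J_tilde n A B g r s}"

text \<open>
  \<open>(\<sigma>f)(x\<^sub>0, \<dots>, x\<^sub>n) = f(x\<^bsub>\<sigma>(0)\<^esub>, \<dots>, x\<^bsub>\<sigma>(n)\<^esub>)\<close>. As \<open>b\<^sub>0 \<otimes> \<dots> \<otimes> b\<^sub>n\<close> is the function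
  \<open>b\<^sub>0(x\<^sub>0) \<cdots> b\<^sub>n(x\<^sub>n)\<close>, the element \<open>b\<^sub>i\<close> moves to the factor number \<open>\<sigma>(i)\<close>:
  the tuple \<open>b\<close> becomes \<open>b \<circ> \<sigma>\<^sup>-\<^sup>1\<close>.
\<close>

definition perm_tensor where
  "perm_tensor n A B g \<sigma> =
     quot_map (free_ring n B) (tensor_ideal n A B g) (lin_ext (\<lambda>b. b \<circ> inv_into UNIV \<sigma>))"

definition perm_Delta where
  "perm_Delta n A B g \<sigma> =
     quot_map (tensor_power n A B g) (J2_ideal n A B g) (perm_tensor n A B g \<sigma>)"


section \<open>The structure sheaf of the scheme of infinitesimal simplices\<close>

text \<open>
  \<open>J\<^sub>r\<^sub>s\<^sup>2\<close> vanishes on \<open>\<Delta>\<^sup>(\<^sup>n\<^sup>)\<close> for all \<open>r, s\<close>, so its underlying space is that of the diagonal \<open>X\<close>,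
  and its structure sheaf and quasi-coherent ideals are sheaves on \<open>X\<close>. A chart is a pair \<open>(U, V)\<close>
  of affine opens \<open>U\<close> of \<open>X\<close> and \<open>V\<close> of \<open>S\<close> with \<open>U\<close> mapping to \<open>V\<close>; the part of
  \<open>\<Delta>\<^sup>(\<^sup>n\<^sup>)\<close> over it is the spectrum of the \<open>Delta_ring\<close> of \<open>\<O>\<^sub>S(V) \<rightarrow> \<O>\<^sub>X(U)\<close>.
  Sections over an open \<open>W\<close> of \<open>X\<close> are the families of elements of these rings, over the charts
  contained in \<open>W\<close>, that are compatible with restriction.
\<close>

definition charts :: "('x, 'r) ringed_space \<Rightarrow> ('s, 'a) ringed_space \<Rightarrow> ('x, 'r, 's, 'a) space_map \<Rightarrow>
    'x set \<Rightarrow> ('x set \<times> 's set) set" where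
  "charts X S \<phi> W =
     {(U, V). affine_open X U \<and> affine_open S V \<and> U \<subseteq> W \<and> pt \<phi> ` U \<subseteq> V}"

definition structure_hom :: "('x, 'r) ringed_space \<Rightarrow> ('x, 'r, 's, 'a) space_map \<Rightarrow>
    'x set \<times> 's set \<Rightarrow> 'a \<Rightarrow> 'r" where
  "structure_hom X \<phi> = (\<lambda>(U, V). res X (preim X \<phi> V) U \<circ> comor \<phi> V)"

definition chart_tensor where
  "chart_tensor n X S \<phi> c =
     tensor_power n (sec S (snd c)) (sec X (fst c)) (structure_hom X \<phi> c)"

definition chart_ring where
  "chart_ring n X S \<phi> c =
     Delta_ring n (sec S (snd c)) (sec X (fst c)) (structure_hom X \<phi> c)"

definition chart_Psi where
  "chart_Psi n X S \<phi> c =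
     Psi_ideal n (sec S (snd c)) (sec X (fst c)) (structure_hom X \<phi> c)"

definition chart_perm where
  "chart_perm n X S \<phi> \<sigma> c =
     perm_Delta n (sec S (snd c)) (sec X (fst c)) (structure_hom X \<phi> c) \<sigma>"

text \<open>Restriction from the chart \<open>c\<close> to a smaller chart \<open>c'\<close>:
  \<open>b\<^sub>0 \<otimes> \<dots> \<otimes> b\<^sub>n\<close> is sent to \<open>b\<^sub>0|\<^bsub>U'\<^esub> \<otimes> \<dots> \<otimes> b\<^sub>n|\<^bsub>U'\<^esub>\<close>.\<close>

definition chart_res where
  "chart_res n X S \<phi> c c' =
     quot_map (chart_tensor n X S \<phi> c')
       (J2_ideal n (sec S (snd c')) (sec X (fst c')) (structure_hom X \<phi> c'))
       (quot_map (free_ring n (sec X (fst c')))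
         (tensor_ideal n (sec S (snd c')) (sec X (fst c')) (structure_hom X \<phi> c'))
         (lin_ext (\<lambda>b. \<lambda>i\<in>{0..n}. res X (fst c) (fst c') (b i))))"

definition Delta_sheaf where
  "Delta_sheaf n X S \<phi> W =
    \<lparr>carrier = {F \<in> (\<Pi>\<^sub>E c \<in> charts X S \<phi> W. carrier (chart_ring n X S \<phi> c)).
        \<forall>c \<in> charts X S \<phi> W. \<forall>c' \<in> charts X S \<phi> W.
          fst c' \<subseteq> fst c \<and> snd c' \<subseteq> snd c \<longrightarrow> chart_res n X S \<phi> c c' (F c) = F c'},
     monoid.mult = (\<lambda>F G. \<lambda>c \<in> charts X S \<phi> W. F c \<otimes>\<^bsub>chart_ring n X S \<phi> c\<^esub> G c),
     one = (\<lambda>c \<in> charts X S \<phi> W. \<one>\<^bsub>chart_ring n X S \<phi> c\<^esub>),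
     zero = (\<lambda>c \<in> charts X S \<phi> W. \<zero>\<^bsub>chart_ring n X S \<phi> c\<^esub>),
     add = (\<lambda>F G. \<lambda>c \<in> charts X S \<phi> W. F c \<oplus>\<^bsub>chart_ring n X S \<phi> c\<^esub> G c)\<rparr>"

definition Psi_sheaf where
  "Psi_sheaf n X S \<phi> W =
     {F \<in> carrier (Delta_sheaf n X S \<phi> W). \<forall>c \<in> charts X S \<phi> W. F c \<in> chart_Psi n X S \<phi> c}"

definition perm_action where
  "perm_action n X S \<phi> W \<sigma> F = (\<lambda>c \<in> charts X S \<phi> W. chart_perm n X S \<phi> \<sigma> c (F c))"

end

theory Submission
  imports Defs
begin

text \<open>
  Fix a chart, with rings \<open>A \<rightarrow> B\<close>, and the transposition \<open>\<tau>\<close> of \<open>r\<close> and \<open>s\<close>. Write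
  \<open>d b = b(x\<^sub>s) - b(x\<^sub>r)\<close>. A pure tensor is a product \<open>t = w a(x\<^sub>r) b(x\<^sub>s)\<close>, where \<open>w\<close> has the entry \<open>1\<close>
  at \<open>r\<close> and at \<open>s\<close> and is thus fixed by \<open>\<tau>\<close>. It satisfies
  \<open>t - \<tau>t = w (a(x\<^sub>r) d b - b(x\<^sub>r) d a) \<in> J\<^sub>r\<^sub>s\<close>, so by additivity \<open>\<tau>\<close> is the identity
  modulo \<open>J\<^sub>r\<^sub>s\<close> (\<open>minus_transpose_in_J\<close>). On the other hand \<open>\<tau>(d b) = -d b\<close>. Hence for a multiple
  \<open>c d b\<close> of a generator of \<open>J\<^sub>r\<^sub>s\<close> we have \<open>\<tau>(c d b) + c d b = (c - \<tau>c) d b \<in> J\<^sub>r\<^sub>s\<^sup>2\<close>, and therefore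
  \<open>\<tau>\<close> acts as \<open>-1\<close> on the image of \<open>J\<^sub>r\<^sub>s\<close> in the ring of \<open>\<Delta>\<^sup>(\<^sup>n\<^sup>)\<close> (\<open>perm_Delta_transpose\<close>). An
  element of \<open>\<Psi>\<^sup>(\<^sup>n\<^sup>)\<close> lies in all these images, so every transposition sends it to its
  negative. As the transpositions generate the symmetric group, \<open>\<sigma>\<close> acts by its sign
  (\<open>perm_Delta_Psi_ideal\<close>).

  It remains to know that the maps of tensor powers that occur, which permute the factors or restrict
  them to a smaller chart, are well-defined ring homomorphisms. Both are treated together in the
  locale \<open>tensor_map\<close>. Restriction enters because the multiple of a section by \<open>-1\<close> refers to its
  inverse in the additive monoid of compatible families: the chartwise negative of a compatible family
  has to be compatible again.
\<close>

section \<open>The free ring on tuples\<close>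

lemma lin_ext_superset:
  assumes "finite S" "Poly_Mapping.keys F \<subseteq> S"
  shows "lin_ext h F = (\<Sum>b\<in>S. Poly_Mapping.single (h b) (Poly_Mapping.lookup F b))"
  unfolding lin_ext_def
  by (rule sum.mono_neutral_left) (use assms in \<open>auto simp: in_keys_iff\<close>)

lemma lin_ext_zero [simp]: "lin_ext h 0 = 0"
  by (simp add: lin_ext_def)

lemma lin_ext_single [simp]: "lin_ext h (Poly_Mapping.single b k) = Poly_Mapping.single (h b) k"
  by (subst lin_ext_superset[where S = "{b}"]) auto

lemma lin_ext_add: "lin_ext h (F + G) = lin_ext h F + lin_ext h G"
proof -
  let ?S = "Poly_Mapping.keys F \<union> Poly_Mapping.keys G"
  have "Poly_Mapping.keys (F + G) \<subseteq> ?S"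
    by (rule Poly_Mapping.keys_add)
  then show ?thesis
    by (simp add: lin_ext_superset[where S = ?S] lookup_add single_add sum.distrib)
qed

lemma lin_ext_diff: "lin_ext h (F - G) = lin_ext h F - lin_ext h G"
  using lin_ext_add[of h "F - G" G] by (simp add: algebra_simps)

lemma keys_single_subset: "b \<in> T \<Longrightarrow> Poly_Mapping.keys (Poly_Mapping.single b k) \<subseteq> T"
  by (simp add: keys_single)

lemma keys_add_subset:
  "Poly_Mapping.keys F \<subseteq> T \<Longrightarrow> Poly_Mapping.keys G \<subseteq> T \<Longrightarrow> Poly_Mapping.keys (F + G) \<subseteq> T"
  using Poly_Mapping.keys_add[of F G] by blast

lemma keys_diff_subset:
  fixes F G :: "'b \<Rightarrow>\<^sub>0 int"
  shows "Poly_Mapping.keys F \<subseteq> T \<Longrightarrow> Poly_Mapping.keys G \<subseteq> T \<Longrightarrow> Poly_Mapping.keys (F - G) \<subseteq> T"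
  using Poly_Mapping.keys_diff[of F G] by blast

lemma keys_sum_subset:
  "(\<And>i. i \<in> I \<Longrightarrow> Poly_Mapping.keys (F i) \<subseteq> T) \<Longrightarrow> Poly_Mapping.keys (sum F I) \<subseteq> T"
proof (induction I rule: infinite_finite_induct)
  case (insert i I)
  then have "Poly_Mapping.keys (F i) \<subseteq> T" "Poly_Mapping.keys (sum F I) \<subseteq> T"
    by blast+
  then show ?case
    unfolding sum.insert[OF insert(1,2)] by (rule keys_add_subset)
qed simp_all

text \<open>An additive property of the elements supported on \<open>T\<close> needs checking on single multiples of
  basis elements only.\<close>

lemma tfree_induct [consumes 1, case_names zero single add]:
  fixes F :: "'b \<Rightarrow>\<^sub>0 int"
  assumes "Poly_Mapping.keys F \<subseteq> T"
    and "P 0"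
    and "\<And>b k. b \<in> T \<Longrightarrow> P (Poly_Mapping.single b k)"
    and "\<And>F G. \<lbrakk>Poly_Mapping.keys F \<subseteq> T; Poly_Mapping.keys G \<subseteq> T; P F; P G\<rbrakk> \<Longrightarrow> P (F + G)"
  shows "P F"
proof -
  have "P (\<Sum>b\<in>S. Poly_Mapping.single b (Poly_Mapping.lookup F b))" if "finite S" "S \<subseteq> T" for S
    using that
  proof (induction S rule: finite_induct)
    case (insert b S)
    then show ?case
      by (auto intro!: assms(3,4) keys_single_subset keys_sum_subset)
  qed (simp add: assms(2))
  moreover have "(\<Sum>b\<in>Poly_Mapping.keys F. Poly_Mapping.single b (Poly_Mapping.lookup F b)) = F"
    by (rule poly_mapping_eqI) (auto simp: lookup_sum lookup_single when_def in_keys_iff)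
  ultimately show ?thesis
    using assms(1) by (metis finite_keys)
qed

lemma lin_ext_keys:
  assumes "Poly_Mapping.keys F \<subseteq> T" "\<And>b. b \<in> T \<Longrightarrow> h b \<in> T'"
  shows "Poly_Mapping.keys (lin_ext h F) \<subseteq> T'"
  unfolding lin_ext_def using assms by (auto intro!: keys_sum_subset keys_single_subset)

lemma lin_ext_comp:
  assumes "Poly_Mapping.keys F \<subseteq> T" "\<And>b. b \<in> T \<Longrightarrow> h'' b = h (h' b)"
  shows "lin_ext h'' F = lin_ext h (lin_ext h' F)"
  using assms(1) by (induction rule: tfree_induct) (simp_all add: assms(2) lin_ext_add)

lemma lin_ext_ident:
  assumes "Poly_Mapping.keys F \<subseteq> T" "\<And>b. b \<in> T \<Longrightarrow> h b = b"
  shows "lin_ext h F = F"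
  using assms(1) by (induction rule: tfree_induct) (simp_all add: assms(2) lin_ext_add)

lemma carrier_free_ring: "F \<in> carrier (free_ring n B) \<longleftrightarrow> Poly_Mapping.keys F \<subseteq> tuples n B"
  by (simp add: free_ring_def)

lemma zero_free_ring [simp]: "\<zero>\<^bsub>free_ring n B\<^esub> = 0"
  by (simp add: free_ring_def)

lemma add_free_ring [simp]: "F \<oplus>\<^bsub>free_ring n B\<^esub> G = F + G"
  by (simp add: free_ring_def)

lemma one_free_ring: "\<one>\<^bsub>free_ring n B\<^esub> = pure (\<lambda>i\<in>{0..n}. \<one>\<^bsub>B\<^esub>)"
  by (simp add: free_ring_def)

text \<open>Enlarging the ranges of summation makes the two factors independent of their supports,
  which is what bilinearity needs.\<close>

lemma mult_free_ring_superset: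
  assumes "finite S" "Poly_Mapping.keys F \<subseteq> S" "finite T" "Poly_Mapping.keys G \<subseteq> T"
  shows "F \<otimes>\<^bsub>free_ring n B\<^esub> G =
    (\<Sum>b\<in>S. \<Sum>c\<in>T. Poly_Mapping.single (\<lambda>i\<in>{0..n}. b i \<otimes>\<^bsub>B\<^esub> c i)
               (Poly_Mapping.lookup F b * Poly_Mapping.lookup G c))"
proof -
  have "F \<otimes>\<^bsub>free_ring n B\<^esub> G = (\<Sum>b\<in>Poly_Mapping.keys F. \<Sum>c\<in>T.
      Poly_Mapping.single (\<lambda>i\<in>{0..n}. b i \<otimes>\<^bsub>B\<^esub> c i)
               (Poly_Mapping.lookup F b * Poly_Mapping.lookup G c))"
    unfolding free_ring_def monoid.simps
    by (intro sum.cong refl sum.mono_neutral_left) (use assms in \<open>auto simp: in_keys_iff\<close>)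
  also have "\<dots> = (\<Sum>b\<in>S. \<Sum>c\<in>T. Poly_Mapping.single (\<lambda>i\<in>{0..n}. b i \<otimes>\<^bsub>B\<^esub> c i)
               (Poly_Mapping.lookup F b * Poly_Mapping.lookup G c))"
    by (intro sum.mono_neutral_left) (use assms in \<open>auto simp: in_keys_iff\<close>)
  finally show ?thesis .
qed

lemma mult_free_ring_single [simp]:
  "Poly_Mapping.single b k \<otimes>\<^bsub>free_ring n B\<^esub> Poly_Mapping.single c l =
     Poly_Mapping.single (\<lambda>i\<in>{0..n}. b i \<otimes>\<^bsub>B\<^esub> c i) (k * l)"
  by (subst mult_free_ring_superset[where S = "{b}" and T = "{c}"]) auto

lemma mult_free_ring_zero [simp]:
  "0 \<otimes>\<^bsub>free_ring n B\<^esub> F = 0" "F \<otimes>\<^bsub>free_ring n B\<^esub> 0 = 0"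
  by (simp_all add: free_ring_def)

lemma mult_free_ring_add_left:
  "(F + G) \<otimes>\<^bsub>free_ring n B\<^esub> H = F \<otimes>\<^bsub>free_ring n B\<^esub> H + G \<otimes>\<^bsub>free_ring n B\<^esub> H"
proof -
  let ?S = "Poly_Mapping.keys F \<union> Poly_Mapping.keys G"
  have "Poly_Mapping.keys (F + G) \<subseteq> ?S"
    by (rule Poly_Mapping.keys_add)
  then show ?thesis
    by (simp add: mult_free_ring_superset[where S = ?S and T = "Poly_Mapping.keys H"] lookup_add
        single_add sum.distrib algebra_simps)
qed

lemma mult_free_ring_add_right:
  "H \<otimes>\<^bsub>free_ring n B\<^esub> (F + G) = H \<otimes>\<^bsub>free_ring n B\<^esub> F + H \<otimes>\<^bsub>free_ring n B\<^esub> G"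
proof -
  let ?S = "Poly_Mapping.keys F \<union> Poly_Mapping.keys G"
  have "Poly_Mapping.keys (F + G) \<subseteq> ?S"
    by (rule Poly_Mapping.keys_add)
  then show ?thesis
    by (simp add: mult_free_ring_superset[where T = ?S and S = "Poly_Mapping.keys H"] lookup_add
        single_add sum.distrib algebra_simps)
qed

lemmas mult_free_ring_bilinear = mult_free_ring_add_left mult_free_ring_add_right

lemma (in ring) tuples_mult:
  "b \<in> tuples n R \<Longrightarrow> c \<in> tuples n R \<Longrightarrow> (\<lambda>i\<in>{0..n}. b i \<otimes> c i) \<in> tuples n R"
  by (auto simp: tuples_def)

lemma tuplesD: "b \<in> tuples n B \<Longrightarrow> i \<le> n \<Longrightarrow> b i \<in> carrier B"
  by (auto simp: tuples_def)

lemma tuples_upd: "b \<in> tuples n B \<Longrightarrow> i \<le> n \<Longrightarrow> x \<in> carrier B \<Longrightarrow> b(i := x) \<in> tuples n B"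
  by (auto simp: tuples_def PiE_iff extensional_def)

lemma (in ring) tuples_one: "(\<lambda>i\<in>{0..n}. \<one>) \<in> tuples n R"
  by (auto simp: tuples_def)

lemma (in ring) mult_free_ring_keys:
  assumes "Poly_Mapping.keys F \<subseteq> tuples n R" "Poly_Mapping.keys H \<subseteq> tuples n R"
  shows "Poly_Mapping.keys (F \<otimes>\<^bsub>free_ring n R\<^esub> H) \<subseteq> tuples n R"
  unfolding free_ring_def monoid.simps
  using assms by (intro keys_sum_subset keys_single_subset tuples_mult) auto

lemma (in cring) free_ring_cring: "cring (free_ring n R)"
proof (rule cringI)
  show "abelian_group (free_ring n R)"
  proof (rule abelian_groupI)
    fix F assume "F \<in> carrier (free_ring n R)"
    then show "\<exists>G\<in>carrier (free_ring n R). G \<oplus>\<^bsub>free_ring n R\<^esub> F = \<zero>\<^bsub>free_ring n R\<^esub>"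
      by (intro bexI[of _ "- F"]) (auto simp: carrier_free_ring)
  qed (auto simp: carrier_free_ring add_ac dest: keys_add_subset)
next
  let ?T = "tuples n R"
  show "comm_monoid (free_ring n R)"
  proof (rule comm_monoidI)
    show "F \<otimes>\<^bsub>free_ring n R\<^esub> G \<in> carrier (free_ring n R)"
      if "F \<in> carrier (free_ring n R)" "G \<in> carrier (free_ring n R)" for F G
      using that mult_free_ring_keys by (simp add: carrier_free_ring)
    show "\<one>\<^bsub>free_ring n R\<^esub> \<in> carrier (free_ring n R)"
      using tuples_one by (simp add: carrier_free_ring one_free_ring)
    show "F \<otimes>\<^bsub>free_ring n R\<^esub> G \<otimes>\<^bsub>free_ring n R\<^esub> H =
        F \<otimes>\<^bsub>free_ring n R\<^esub> (G \<otimes>\<^bsub>free_ring n R\<^esub> H)"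
      if F: "F \<in> carrier (free_ring n R)" and G: "G \<in> carrier (free_ring n R)"
        and H: "H \<in> carrier (free_ring n R)" for F G H
      using F[unfolded carrier_free_ring]
    proof (induction rule: tfree_induct)
      case (single a k)
      show ?case
        using G[unfolded carrier_free_ring]
      proof (induction rule: tfree_induct)
        case (single b l)
        show ?case
          using H[unfolded carrier_free_ring]
        proof (induction rule: tfree_induct)
          case (single c m)
          have "(\<lambda>i\<in>{0..n}. (\<lambda>i\<in>{0..n}. a i \<otimes> b i) i \<otimes> c i) =
              (\<lambda>i\<in>{0..n}. a i \<otimes> (\<lambda>i\<in>{0..n}. b i \<otimes> c i) i)"
            using \<open>a \<in> ?T\<close> \<open>b \<in> ?T\<close> \<open>c \<in> ?T\<close> by (auto simp: fun_eq_iff m_assoc tuplesD)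
          then show ?case
            by (simp add: mult.assoc)
        qed (simp_all add: mult_free_ring_bilinear)
      qed (simp_all add: mult_free_ring_bilinear)
    qed (simp_all add: mult_free_ring_bilinear)
    show "F \<otimes>\<^bsub>free_ring n R\<^esub> G = G \<otimes>\<^bsub>free_ring n R\<^esub> F"
      if F: "F \<in> carrier (free_ring n R)" and G: "G \<in> carrier (free_ring n R)" for F G
      using F[unfolded carrier_free_ring]
    proof (induction rule: tfree_induct)
      case (single a k)
      show ?case
        using G[unfolded carrier_free_ring]
      proof (induction rule: tfree_induct)
        case (single b l)
        have "(\<lambda>i\<in>{0..n}. a i \<otimes> b i) = (\<lambda>i\<in>{0..n}. b i \<otimes> a i)"
          using \<open>a \<in> ?T\<close> \<open>b \<in> ?T\<close> by (auto simp: fun_eq_iff m_comm tuplesD)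
        then show ?case
          by (simp add: mult.commute)
      qed (simp_all add: mult_free_ring_bilinear)
    qed (simp_all add: mult_free_ring_bilinear)
    show "\<one>\<^bsub>free_ring n R\<^esub> \<otimes>\<^bsub>free_ring n R\<^esub> F = F" if F: "F \<in> carrier (free_ring n R)" for F
      using F[unfolded carrier_free_ring]
    proof (induction rule: tfree_induct)
      case (single a k)
      have "(\<lambda>i\<in>{0..n}. (\<lambda>i\<in>{0..n}. \<one>) i \<otimes> a i) = a"
        using single by (auto simp: fun_eq_iff tuples_def PiE_iff extensional_def)
      then show ?case
        by (simp add: one_free_ring)
    qed (simp_all add: mult_free_ring_bilinear)
  qed
qed (simp add: mult_free_ring_bilinear)

lemma lin_ext_ring_hom:
  assumes tup: "\<And>b. b \<in> tuples n B \<Longrightarrow> h b \<in> tuples n B'"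
    and one: "h (\<lambda>i\<in>{0..n}. \<one>\<^bsub>B\<^esub>) = (\<lambda>i\<in>{0..n}. \<one>\<^bsub>B'\<^esub>)"
    and mult: "\<And>b c. b \<in> tuples n B \<Longrightarrow> c \<in> tuples n B \<Longrightarrow>
      h (\<lambda>i\<in>{0..n}. b i \<otimes>\<^bsub>B\<^esub> c i) = (\<lambda>i\<in>{0..n}. h b i \<otimes>\<^bsub>B'\<^esub> h c i)"
  shows "lin_ext h \<in> ring_hom (free_ring n B) (free_ring n B')"
proof (rule ring_hom_memI)
  show "lin_ext h F \<in> carrier (free_ring n B')" if "F \<in> carrier (free_ring n B)" for F
    using that tup lin_ext_keys unfolding carrier_free_ring by blast
  show "lin_ext h (F \<otimes>\<^bsub>free_ring n B\<^esub> G) = lin_ext h F \<otimes>\<^bsub>free_ring n B'\<^esub> lin_ext h G"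
    if F: "F \<in> carrier (free_ring n B)" and G: "G \<in> carrier (free_ring n B)" for F G
    using F[unfolded carrier_free_ring]
  proof (induction rule: tfree_induct)
    case (single a k)
    show ?case
      using G[unfolded carrier_free_ring]
      by (induction rule: tfree_induct)
        (simp_all add: single mult mult_free_ring_bilinear lin_ext_add)
  qed (simp_all add: mult_free_ring_bilinear lin_ext_add)
qed (simp_all add: lin_ext_add one_free_ring one)

section \<open>Homomorphisms of quotient rings\<close>

lemma Idl_image_subset:
  assumes "ring R" "ring R'" "h \<in> ring_hom R R'" "ideal J R'" "S \<subseteq> carrier R" "h ` S \<subseteq> J"
  shows "h ` (Idl\<^bsub>R\<^esub> S) \<subseteq> J"
proof -
  interpret ring_hom_ring R R' h
    using assms by (intro ring_hom_ringI2)
  have "Idl\<^bsub>R\<^esub> S \<subseteq> {r \<in> carrier R. h r \<in> J}"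
    by (rule R.genideal_minimal[OF ideal_vimage]) (use assms in auto)
  then show ?thesis
    by blast
qed

lemma ideal_prod_image_subset:
  assumes "h \<in> ring_hom R R'" "I \<subseteq> carrier R" "J \<subseteq> carrier R"
    and "ring R" "h ` I \<subseteq> I'" "h ` J \<subseteq> J'"
  shows "h ` (I \<cdot>\<^bsub>R\<^esub> J) \<subseteq> I' \<cdot>\<^bsub>R'\<^esub> J'"
proof -
  interpret ring R by fact
  have "x \<in> carrier R \<and> h x \<in> I' \<cdot>\<^bsub>R'\<^esub> J'" if "x \<in> I \<cdot>\<^bsub>R\<^esub> J" for x
    using that
  proof (induction rule: ideal_prod.induct)
    case (prod i j)
    then have "i \<in> carrier R" "j \<in> carrier R" "h i \<in> I'" "h j \<in> J'"
      using assms(2,3,5,6) by blast+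
    then show ?case
      by (simp add: ring_hom_mult[OF assms(1)] ideal_prod.prod)
  next
    case (sum x y)
    then show ?case
      by (simp add: ring_hom_add[OF assms(1)] ideal_prod.sum)
  qed
  then show ?thesis
    by blast
qed

lemma carrier_QuotE:
  assumes "C \<in> carrier (R Quot I)"
  obtains x where "x \<in> carrier R" "C = I +>\<^bsub>R\<^esub> x"
  using assms by (auto simp: FactRing_simps)

lemma quot_map_coset:
  assumes "ideal I R" "ideal J R'" "h \<in> ring_hom R R'" "h ` I \<subseteq> J" "x \<in> carrier R"
  shows "quot_map R' J h (I +>\<^bsub>R\<^esub> x) = J +>\<^bsub>R'\<^esub> h x"
proof -
  interpret I: ideal I R by fact
  interpret J: ideal J R' by fact
  have "J +>\<^bsub>R'\<^esub> h y = J +>\<^bsub>R'\<^esub> h x" if y: "y \<in> I +>\<^bsub>R\<^esub> x" for y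
  proof -
    obtain z where z: "z \<in> I" "y = z \<oplus>\<^bsub>R\<^esub> x"
      using y by (auto simp: a_r_coset_defs)
    have "h y = h z \<oplus>\<^bsub>R'\<^esub> h x"
      using z assms by (simp add: ring_hom_add I.a_Hcarr)
    then have "h y \<in> J +>\<^bsub>R'\<^esub> h x"
      using z assms by (auto simp: a_r_coset_defs)
    then show ?thesis
      using J.a_repr_independence'[of "h y" "h x"] ring_hom_closed[OF assms(3,5)] by simp
  qed
  moreover have "x \<in> I +>\<^bsub>R\<^esub> x"
    using assms by (simp add: I.a_rcos_self)
  ultimately show ?thesis
    unfolding quot_map_def by blast
qed

lemma quot_map_ring_hom:
  assumes "ideal I R" "ideal J R'" "h \<in> ring_hom R R'" "h ` I \<subseteq> J"
  shows "quot_map R' J h \<in> ring_hom (R Quot I) (R' Quot J)"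
proof -
  interpret I: ideal I R by fact
  interpret J: ideal J R' by fact
  note coset = quot_map_coset[OF assms]
  note I_hom = I.rcos_ring_hom and J_hom = J.rcos_ring_hom
  show ?thesis
  proof (rule ring_hom_memI)
    fix C assume "C \<in> carrier (R Quot I)"
    then obtain x where x: "x \<in> carrier R" "C = I +>\<^bsub>R\<^esub> x"
      by (rule carrier_QuotE)
    show "quot_map R' J h C \<in> carrier (R' Quot J)"
      using x assms by (simp add: coset ring_hom_closed[OF J_hom] ring_hom_closed[OF assms(3)])
    fix D assume "D \<in> carrier (R Quot I)"
    then obtain y where y: "y \<in> carrier R" "D = I +>\<^bsub>R\<^esub> y"
      by (rule carrier_QuotE)
    show "quot_map R' J h (C \<otimes>\<^bsub>R Quot I\<^esub> D) = quot_map R' J h C \<otimes>\<^bsub>R' Quot J\<^esub> quot_map R' J h D"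
      using x y assms
      by (simp add: coset ring_hom_mult[OF I_hom, symmetric] ring_hom_mult[OF J_hom, symmetric]
          ring_hom_mult[OF assms(3)] ring_hom_closed[OF assms(3)])
    show "quot_map R' J h (C \<oplus>\<^bsub>R Quot I\<^esub> D) = quot_map R' J h C \<oplus>\<^bsub>R' Quot J\<^esub> quot_map R' J h D"
      using x y assms
      by (simp add: coset ring_hom_add[OF I_hom, symmetric] ring_hom_add[OF J_hom, symmetric]
          ring_hom_add[OF assms(3)] ring_hom_closed[OF assms(3)])
  next
    show "quot_map R' J h \<one>\<^bsub>R Quot I\<^esub> = \<one>\<^bsub>R' Quot J\<^esub>"
      using coset[of "\<one>\<^bsub>R\<^esub>"] ring_hom_one[OF assms(3)] by (simp add: FactRing_def)
  qed
qed

section \<open>Tensor powers and their maps\<close>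

lemma ring_hom_minus:
  assumes "ring R" "ring R'" "h \<in> ring_hom R R'" "x \<in> carrier R" "y \<in> carrier R"
  shows "h (x \<ominus>\<^bsub>R\<^esub> y) = h x \<ominus>\<^bsub>R'\<^esub> h y"
proof -
  interpret ring_hom_ring R R' h
    using assms by (intro ring_hom_ringI2)
  show ?thesis
    using assms by (simp add: a_minus_def)
qed

text \<open>The rings attached to a map \<open>g\<close> from \<open>A\<close> to \<open>B\<close>. Only the image of \<open>g\<close> enters the relations
  of the tensor power, so neither a ring structure on \<open>A\<close> nor a homomorphism is required.\<close>

locale tensor_data =
  fixes n :: nat and A :: "('a, 'k) ring_scheme" and B :: "('r, 'm) ring_scheme" and g :: "'a \<Rightarrow> 'r"
  assumes base_cring: "cring B"
    and scalar_closed: "a \<in> carrier A \<Longrightarrow> g a \<in> carrier B"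
begin

abbreviation "Fr \<equiv> free_ring n B"
abbreviation "TI \<equiv> tensor_ideal n A B g"
abbreviation "TP \<equiv> tensor_power n A B g"
abbreviation "ins' \<equiv> ins n A B g"
abbreviation "d \<equiv> d_elem n A B g"
abbreviation "J \<equiv> J_ideal n A B g"
abbreviation "J2 \<equiv> J2_ideal n A B g"
abbreviation "\<Delta> \<equiv> Delta_ring n A B g"

end

sublocale tensor_data \<subseteq> B: cring B
  by (rule base_cring)

sublocale tensor_data \<subseteq> Fr: cring "free_ring n B"
  by (rule B.free_ring_cring)

context tensor_data
begin

lemma pure_closed: "b \<in> tuples n B \<Longrightarrow> pure b \<in> carrier Fr"
  by (auto simp: carrier_free_ring)

lemma tensor_rel_closed: "tensor_rel n A B g \<subseteq> carrier Fr"
proof -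
  have diff: "F - G \<in> carrier Fr" if "F \<in> carrier Fr" "G \<in> carrier Fr" for F G
    using that keys_diff_subset unfolding carrier_free_ring by blast
  then show ?thesis
    unfolding tensor_rel_def
    by (auto simp: scalar_closed tuplesD intro!: diff pure_closed tuples_upd)
qed

lemma tensor_ideal_ideal: "ideal TI Fr"
  unfolding tensor_ideal_def by (rule Fr.genideal_ideal[OF tensor_rel_closed])

end

sublocale tensor_data \<subseteq> TI: ideal "tensor_ideal n A B g" "free_ring n B"
  by (rule tensor_ideal_ideal)

sublocale tensor_data \<subseteq> TP: cring "tensor_power n A B g"
  unfolding tensor_power_def by (rule TI.quotient_is_cring[OF Fr.is_cring])

context tensor_data
begin

lemma class_hom: "(+>\<^bsub>Fr\<^esub>) TI \<in> ring_hom Fr TP"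
  unfolding tensor_power_def by (rule TI.rcos_ring_hom)

lemma tensor_powerE:
  assumes "t \<in> carrier TP"
  obtains F where "F \<in> carrier Fr" "t = TI +>\<^bsub>Fr\<^esub> F"
  using assms unfolding tensor_power_def by (rule carrier_QuotE)

lemma unit_tuple_upd: "b \<in> carrier B \<Longrightarrow> i \<le> n \<Longrightarrow> (\<lambda>j\<in>{0..n}. \<one>\<^bsub>B\<^esub>)(i := b) \<in> tuples n B"
  by (intro tuples_upd B.tuples_one)

lemma ins_closed [simp, intro]: "b \<in> carrier B \<Longrightarrow> i \<le> n \<Longrightarrow> ins' i b \<in> carrier TP"
  unfolding ins_def by (intro ring_hom_closed[OF class_hom] pure_closed unit_tuple_upd)

lemma d_closed [simp, intro]: "b \<in> carrier B \<Longrightarrow> r \<le> n \<Longrightarrow> s \<le> n \<Longrightarrow> d r s b \<in> carrier TP"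
  unfolding d_elem_def by simp

lemma d_image_closed: "r \<le> n \<Longrightarrow> s \<le> n \<Longrightarrow> d r s ` carrier B \<subseteq> carrier TP"
  by blast

lemma d_swap: "b \<in> carrier B \<Longrightarrow> r \<le> n \<Longrightarrow> s \<le> n \<Longrightarrow> d s r b = \<ominus>\<^bsub>TP\<^esub> d r s b"
  unfolding d_elem_def by (simp add: TP.minus_eq TP.minus_add TP.a_comm)

lemma J_ideal: "r \<le> n \<Longrightarrow> s \<le> n \<Longrightarrow> ideal (J r s) TP"
  unfolding J_ideal_def by (intro TP.genideal_ideal d_image_closed)

lemma d_in_J: "b \<in> carrier B \<Longrightarrow> r \<le> n \<Longrightarrow> s \<le> n \<Longrightarrow> d r s b \<in> J r s"
  unfolding J_ideal_def using TP.genideal_self[OF d_image_closed] by blast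

lemma J_swap_subset:
  assumes "r \<le> n" "s \<le> n"
  shows "J s r \<subseteq> J r s"
proof -
  interpret J: ideal "J r s" TP
    using assms by (rule J_ideal)
  have "d s r ` carrier B \<subseteq> J r s"
    using assms by (auto simp: d_swap[of _ r s] intro!: J.a_inv_closed d_in_J)
  then show ?thesis
    unfolding J_ideal_def[of n A B g s r] by (intro TP.genideal_minimal J.is_ideal)
qed

lemma J_swap: "r \<le> n \<Longrightarrow> s \<le> n \<Longrightarrow> J s r = J r s"
  by (simp add: J_swap_subset subset_antisym)

lemma J_squares_closed:
  "(\<Union>(r, s) \<in> {(r, s). r < s \<and> s \<le> n}. J r s \<cdot>\<^bsub>TP\<^esub> J r s) \<subseteq> carrier TP"
proof -
  have "J r s \<cdot>\<^bsub>TP\<^esub> J r s \<subseteq> carrier TP" if "r < s" "s \<le> n" for r s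
    using that by (intro TP.ideal_prod_in_carrier J_ideal) auto
  then show ?thesis
    by blast
qed

lemma J2_ideal: "ideal J2 TP"
  unfolding J2_ideal_def by (rule TP.genideal_ideal[OF J_squares_closed])

lemma J_square_subset_J2:
  assumes "r \<le> n" "s \<le> n" "r \<noteq> s"
  shows "J r s \<cdot>\<^bsub>TP\<^esub> J r s \<subseteq> J2"
proof -
  have "J r s \<cdot>\<^bsub>TP\<^esub> J r s \<subseteq> J2" if "r < s" "s \<le> n" for r s
    using that TP.genideal_self[OF J_squares_closed] unfolding J2_ideal_def by blast
  moreover have "r < s \<or> s < r"
    using \<open>r \<noteq> s\<close> by auto
  ultimately show ?thesis
    using assms by (metis J_swap)
qed

end

sublocale tensor_data \<subseteq> J2: ideal "J2_ideal n A B g" "tensor_power n A B g"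
  by (rule J2_ideal)

sublocale tensor_data \<subseteq> \<Delta>: cring "Delta_ring n A B g"
  unfolding Delta_ring_def by (rule J2.quotient_is_cring[OF TP.is_cring])

context tensor_data
begin

lemma Delta_class_hom: "(+>\<^bsub>TP\<^esub>) J2 \<in> ring_hom TP \<Delta>"
  unfolding Delta_ring_def by (rule J2.rcos_ring_hom)

lemma Delta_ringE:
  assumes "f \<in> carrier \<Delta>"
  obtains t where "t \<in> carrier TP" "f = J2 +>\<^bsub>TP\<^esub> t"
  using assms unfolding Delta_ring_def by (rule carrier_QuotE)

end

text \<open>
  A commutative square from \<open>A \<rightarrow> B\<close> to \<open>A' \<rightarrow> B'\<close> together with a permutation \<open>\<pi>\<close> of the factors: the
  tuple \<open>b\<close> is sent to the tuple with entry \<open>\<rho> (b\<^bsub>\<pi>(i)\<^esub>)\<close> at \<open>i\<close>, so that factor number \<open>i\<close> of the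
  source becomes factor number \<open>\<pi>\<^sup>-\<^sup>1(i)\<close> of the target. The map of tuples is a parameter \<open>h\<close>, since it
  occurs in different forms that agree only on \<open>tuples n B\<close>.
\<close>

locale tensor_map =
  src: tensor_data n A B g + tgt: tensor_data n A' B' g'
  for n :: nat and A :: "('a, 'k) ring_scheme" and B :: "('r, 'm) ring_scheme" and g :: "'a \<Rightarrow> 'r"
    and A' :: "('b, 'l) ring_scheme" and B' :: "('q, 'p) ring_scheme" and g' :: "'b \<Rightarrow> 'q" +
  fixes \<alpha> :: "'a \<Rightarrow> 'b" and \<rho> :: "'r \<Rightarrow> 'q" and \<pi> :: "nat \<Rightarrow> nat"
    and h :: "(nat \<Rightarrow> 'r) \<Rightarrow> (nat \<Rightarrow> 'q)"
  assumes hom: "\<rho> \<in> ring_hom B B'"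
    and scalar: "a \<in> carrier A \<Longrightarrow> \<alpha> a \<in> carrier A'"
    and commutes: "a \<in> carrier A \<Longrightarrow> \<rho> (g a) = g' (\<alpha> a)"
    and perm: "\<pi> permutes {0..n}"
    and map_tuple: "b \<in> tuples n B \<Longrightarrow> h b = (\<lambda>i\<in>{0..n}. \<rho> (b (\<pi> i)))"
begin

abbreviation \<pi>' :: "nat \<Rightarrow> nat" where "\<pi>' \<equiv> inv_into UNIV \<pi>"

lemma perm_le: "\<pi> i \<le> n \<longleftrightarrow> i \<le> n" "\<pi>' i \<le> n \<longleftrightarrow> i \<le> n"
  using permutes_in_image[OF perm, of i] permutes_in_image[OF permutes_inv[OF perm], of i] by auto

lemma map_tuple_closed: "b \<in> tuples n B \<Longrightarrow> h b \<in> tuples n B'"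
  unfolding map_tuple
  by (auto simp: tuples_def[of n B'] perm_le intro!: ring_hom_closed[OF hom] tuplesD)

lemma map_tuple_apply: "b \<in> tuples n B \<Longrightarrow> i \<le> n \<Longrightarrow> h b (\<pi>' i) = \<rho> (b i)"
  using permutes_inverses[OF perm] by (simp add: map_tuple perm_le)

lemma map_tuple_upd:
  assumes "b \<in> tuples n B" "i \<le> n" "x \<in> carrier B"
  shows "h (b(i := x)) = (h b)(\<pi>' i := \<rho> x)"
proof -
  have "\<pi> j = i \<longleftrightarrow> j = \<pi>' i" for j
    using permutes_inverses[OF perm] by metis
  then show ?thesis
    using assms perm_le by (auto simp: map_tuple tuples_upd fun_eq_iff)
qed

lemma map_tuple_one: "h (\<lambda>i\<in>{0..n}. \<one>\<^bsub>B\<^esub>) = (\<lambda>i\<in>{0..n}. \<one>\<^bsub>B'\<^esub>)"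
  using perm_le by (auto simp: map_tuple src.B.tuples_one ring_hom_one[OF hom] fun_eq_iff)

lemma lin_ext_hom: "lin_ext h \<in> ring_hom src.Fr tgt.Fr"
proof (rule lin_ext_ring_hom)
  show "h (\<lambda>i\<in>{0..n}. b i \<otimes>\<^bsub>B\<^esub> c i) = (\<lambda>i\<in>{0..n}. h b i \<otimes>\<^bsub>B'\<^esub> h c i)"
    if "b \<in> tuples n B" "c \<in> tuples n B" for b c
    using that perm_le
    by (auto simp: map_tuple src.B.tuples_mult ring_hom_mult[OF hom] tuplesD fun_eq_iff)
qed (use map_tuple_closed map_tuple_one in auto)

lemma tensor_ideal_image: "lin_ext h ` src.TI \<subseteq> tgt.TI"
proof -
  have "lin_ext h ` tensor_rel n A B g \<subseteq> tensor_rel n A' B' g'"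
  proof
    fix y assume "y \<in> lin_ext h ` tensor_rel n A B g"
    then obtain x where x: "x \<in> tensor_rel n A B g" "y = lin_ext h x"
      by blast
    from x(1) consider
        (add) u i b c where "x = pure (u(i := b \<oplus>\<^bsub>B\<^esub> c)) - pure (u(i := b)) - pure (u(i := c))"
          "u \<in> tuples n B" "i \<le> n" "b \<in> carrier B" "c \<in> carrier B"
      | (scale) u i j a where "x = pure (u(i := g a \<otimes>\<^bsub>B\<^esub> u i)) - pure (u(j := g a \<otimes>\<^bsub>B\<^esub> u j))"
          "u \<in> tuples n B" "i \<le> n" "j \<le> n" "a \<in> carrier A"
      unfolding tensor_rel_def by blast
    then show "y \<in> tensor_rel n A' B' g'"
    proof cases
      case add
      then have "y = pure ((h u)(\<pi>' i := \<rho> b \<oplus>\<^bsub>B'\<^esub> \<rho> c)) - pure ((h u)(\<pi>' i := \<rho> b))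
          - pure ((h u)(\<pi>' i := \<rho> c))"
        using x(2) by (simp add: lin_ext_diff map_tuple_upd ring_hom_add[OF hom])
      moreover have "h u \<in> tuples n B'" "\<pi>' i \<le> n" "\<rho> b \<in> carrier B'" "\<rho> c \<in> carrier B'"
        using add by (auto simp: map_tuple_closed perm_le ring_hom_closed[OF hom])
      ultimately show ?thesis
        unfolding tensor_rel_def by blast
    next
      case scale
      then have "y = pure ((h u)(\<pi>' i := g' (\<alpha> a) \<otimes>\<^bsub>B'\<^esub> h u (\<pi>' i)))
          - pure ((h u)(\<pi>' j := g' (\<alpha> a) \<otimes>\<^bsub>B'\<^esub> h u (\<pi>' j)))"
        using x(2) by (simp add: lin_ext_diff map_tuple_upd map_tuple_apply tuplesD
            src.scalar_closed ring_hom_mult[OF hom] commutes)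
      moreover have "h u \<in> tuples n B'" "\<pi>' i \<le> n" "\<pi>' j \<le> n" "\<alpha> a \<in> carrier A'"
        using scale by (auto simp: map_tuple_closed perm_le scalar)
      ultimately show ?thesis
        unfolding tensor_rel_def by blast
    qed
  qed
  also have "\<dots> \<subseteq> tgt.TI"
    unfolding tensor_ideal_def by (rule tgt.Fr.genideal_self[OF tgt.tensor_rel_closed])
  finally show ?thesis
    unfolding tensor_ideal_def[of n A B g]
    by (intro Idl_image_subset[OF src.Fr.ring_axioms tgt.Fr.ring_axioms lin_ext_hom
          tgt.tensor_ideal_ideal src.tensor_rel_closed])
qed

text \<open>The map induced on tensor powers.\<close>

definition tmap :: "'r tfree set \<Rightarrow> 'q tfree set" where
  "tmap = quot_map tgt.Fr tgt.TI (lin_ext h)"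

text \<open>The map induced on the rings of infinitesimal simplices.\<close>

definition Dmap :: "'r tfree set set \<Rightarrow> 'q tfree set set" where
  "Dmap = quot_map tgt.TP tgt.J2 tmap"

lemma tmap_class: "F \<in> carrier src.Fr \<Longrightarrow> tmap (src.TI +>\<^bsub>src.Fr\<^esub> F) = tgt.TI +>\<^bsub>tgt.Fr\<^esub> lin_ext h F"
  unfolding tmap_def
  by (intro quot_map_coset src.tensor_ideal_ideal tgt.tensor_ideal_ideal lin_ext_hom tensor_ideal_image)

lemma tmap_hom: "tmap \<in> ring_hom src.TP tgt.TP"
  unfolding tmap_def tensor_power_def
  by (intro quot_map_ring_hom src.tensor_ideal_ideal tgt.tensor_ideal_ideal lin_ext_hom tensor_ideal_image)

lemma tmap_ins: "b \<in> carrier B \<Longrightarrow> i \<le> n \<Longrightarrow> tmap (src.ins' i b) = tgt.ins' (\<pi>' i) (\<rho> b)"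
  unfolding ins_def
  by (simp add: tmap_class src.pure_closed src.unit_tuple_upd map_tuple_upd src.B.tuples_one
      map_tuple_one)

lemma tmap_d:
  assumes "b \<in> carrier B" "r \<le> n" "s \<le> n"
  shows "tmap (src.d r s b) = tgt.d (\<pi>' r) (\<pi>' s) (\<rho> b)"
  unfolding d_elem_def using assms
  by (simp add: ring_hom_minus[OF src.TP.ring_axioms tgt.TP.ring_axioms tmap_hom] tmap_ins)

lemma tmap_J:
  assumes "r \<le> n" "s \<le> n"
  shows "tmap ` src.J r s \<subseteq> tgt.J (\<pi>' r) (\<pi>' s)"
  unfolding J_ideal_def[of n A B g]
  by (rule Idl_image_subset[OF src.TP.ring_axioms tgt.TP.ring_axioms tmap_hom tgt.J_ideal
        src.d_image_closed])
    (use assms in \<open>auto simp: perm_le tmap_d ring_hom_closed[OF hom] intro!: tgt.d_in_J\<close>)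

lemma tmap_J2: "tmap ` src.J2 \<subseteq> tgt.J2"
proof -
  have "tmap ` (src.J r s \<cdot>\<^bsub>src.TP\<^esub> src.J r s) \<subseteq> tgt.J2" if "r < s" "s \<le> n" for r s
  proof -
    have le: "r \<le> n" "s \<le> n" and neq: "\<pi>' r \<noteq> \<pi>' s"
      using that permutes_inverses[OF perm] by (auto, metis nat_neq_iff)
    have J: "src.J r s \<subseteq> carrier src.TP"
      using ideal.Icarr[OF src.J_ideal[OF le]] by blast
    have "tmap ` (src.J r s \<cdot>\<^bsub>src.TP\<^esub> src.J r s)
        \<subseteq> tgt.J (\<pi>' r) (\<pi>' s) \<cdot>\<^bsub>tgt.TP\<^esub> tgt.J (\<pi>' r) (\<pi>' s)"
      by (intro ideal_prod_image_subset[OF tmap_hom J J src.TP.ring_axioms] tmap_J le)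
    also have "\<dots> \<subseteq> tgt.J2"
      using le neq by (intro tgt.J_square_subset_J2) (auto simp: perm_le)
    finally show ?thesis .
  qed
  then show ?thesis
    unfolding J2_ideal_def[of n A B g]
    by (intro Idl_image_subset[OF src.TP.ring_axioms tgt.TP.ring_axioms tmap_hom tgt.J2_ideal
          src.J_squares_closed]) blast
qed

lemma Dmap_class: "t \<in> carrier src.TP \<Longrightarrow> Dmap (src.J2 +>\<^bsub>src.TP\<^esub> t) = tgt.J2 +>\<^bsub>tgt.TP\<^esub> tmap t"
  unfolding Dmap_def by (intro quot_map_coset src.J2_ideal tgt.J2_ideal tmap_hom tmap_J2)

lemma Dmap_hom: "Dmap \<in> ring_hom src.\<Delta> tgt.\<Delta>"
  unfolding Dmap_def Delta_ring_def
  by (intro quot_map_ring_hom src.J2_ideal tgt.J2_ideal tmap_hom tmap_J2)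

end

section \<open>The action of permutations over a chart\<close>

context tensor_data
begin

lemma perm_tensor_map:
  assumes "\<sigma> permutes {0..n}"
  shows "tensor_map n A B g A B g id id (inv_into UNIV \<sigma>) (\<lambda>b. b \<circ> inv_into UNIV \<sigma>)"
proof unfold_locales
  fix b assume "b \<in> tuples n B"
  moreover have "inv_into UNIV \<sigma> i = i" if "\<not> i \<le> n" for i
    using permutes_not_in[OF permutes_inv[OF assms], of i] that by simp
  ultimately show "b \<circ> inv_into UNIV \<sigma> = (\<lambda>i\<in>{0..n}. id (b (inv_into UNIV \<sigma> i)))"
    by (auto simp: fun_eq_iff tuples_def PiE_iff extensional_def)
qed (use assms in \<open>auto simp: ring_hom_def permutes_inv\<close>)

context
  fixes \<sigma> :: "nat \<Rightarrow> nat"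
  assumes \<sigma>: "\<sigma> permutes {0..n}"
begin

interpretation p: tensor_map n A B g A B g id id "inv_into UNIV \<sigma>" "\<lambda>b. b \<circ> inv_into UNIV \<sigma>"
  by (rule perm_tensor_map[OF \<sigma>])

lemma perm_tensor_class:
  "F \<in> carrier Fr \<Longrightarrow> perm_tensor n A B g \<sigma> (TI +>\<^bsub>Fr\<^esub> F) =
     TI +>\<^bsub>Fr\<^esub> lin_ext (\<lambda>b. b \<circ> inv_into UNIV \<sigma>) F"
  using p.tmap_class unfolding p.tmap_def perm_tensor_def .

lemma lin_ext_perm_closed:
  "F \<in> carrier Fr \<Longrightarrow> lin_ext (\<lambda>b. b \<circ> inv_into UNIV \<sigma>) F \<in> carrier Fr"
  by (rule ring_hom_closed[OF p.lin_ext_hom])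

lemma perm_tensor_hom: "perm_tensor n A B g \<sigma> \<in> ring_hom TP TP"
  using p.tmap_hom unfolding p.tmap_def perm_tensor_def .

lemma perm_tensor_closed: "t \<in> carrier TP \<Longrightarrow> perm_tensor n A B g \<sigma> t \<in> carrier TP"
  by (rule ring_hom_closed[OF perm_tensor_hom])

lemma perm_tensor_ins:
  "b \<in> carrier B \<Longrightarrow> i \<le> n \<Longrightarrow> perm_tensor n A B g \<sigma> (ins' i b) = ins' (\<sigma> i) b"
  using p.tmap_ins[of b i] permutes_inv_inv[OF \<sigma>] unfolding p.tmap_def perm_tensor_def by simp

lemma perm_tensor_d:
  "b \<in> carrier B \<Longrightarrow> r \<le> n \<Longrightarrow> s \<le> n \<Longrightarrow> perm_tensor n A B g \<sigma> (d r s b) = d (\<sigma> r) (\<sigma> s) b"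
  using p.tmap_d[of b r s] permutes_inv_inv[OF \<sigma>] unfolding p.tmap_def perm_tensor_def by simp

lemma perm_Delta_class:
  "t \<in> carrier TP \<Longrightarrow> perm_Delta n A B g \<sigma> (J2 +>\<^bsub>TP\<^esub> t) = J2 +>\<^bsub>TP\<^esub> perm_tensor n A B g \<sigma> t"
  using p.Dmap_class unfolding p.Dmap_def p.tmap_def perm_Delta_def perm_tensor_def .

lemma perm_Delta_hom: "perm_Delta n A B g \<sigma> \<in> ring_hom \<Delta> \<Delta>"
  using p.Dmap_hom unfolding p.Dmap_def p.tmap_def perm_Delta_def perm_tensor_def .

lemma perm_Delta_minus:
  assumes "f \<in> carrier \<Delta>"
  shows "perm_Delta n A B g \<sigma> (\<ominus>\<^bsub>\<Delta>\<^esub> f) = \<ominus>\<^bsub>\<Delta>\<^esub> perm_Delta n A B g \<sigma> f"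
proof -
  interpret ring_hom_ring \<Delta> \<Delta> "perm_Delta n A B g \<sigma>"
    using \<Delta>.ring_axioms perm_Delta_hom by (intro ring_hom_ringI2)
  show ?thesis
    using assms by simp
qed

end

lemma perm_Delta_id:
  assumes "f \<in> carrier \<Delta>"
  shows "perm_Delta n A B g id f = f"
proof -
  obtain t where t: "t \<in> carrier TP" "f = J2 +>\<^bsub>TP\<^esub> t"
    using assms by (rule Delta_ringE)
  obtain F where F: "F \<in> carrier Fr" "t = TI +>\<^bsub>Fr\<^esub> F"
    using t(1) by (rule tensor_powerE)
  have "lin_ext (\<lambda>b. b \<circ> inv_into UNIV id) F = F"
    using F(1)[unfolded carrier_free_ring] by (rule lin_ext_ident) simp
  then show ?thesis
    using t F by (simp add: perm_Delta_class perm_tensor_class permutes_id)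
qed

lemma perm_Delta_comp:
  assumes \<sigma>: "\<sigma> permutes {0..n}" and \<tau>: "\<tau> permutes {0..n}" and f: "f \<in> carrier \<Delta>"
  shows "perm_Delta n A B g (\<sigma> \<circ> \<tau>) f = perm_Delta n A B g \<sigma> (perm_Delta n A B g \<tau> f)"
proof -
  obtain t where t: "t \<in> carrier TP" "f = J2 +>\<^bsub>TP\<^esub> t"
    using f by (rule Delta_ringE)
  obtain F where F: "F \<in> carrier Fr" "t = TI +>\<^bsub>Fr\<^esub> F"
    using t(1) by (rule tensor_powerE)
  have "lin_ext (\<lambda>b. b \<circ> inv_into UNIV (\<sigma> \<circ> \<tau>)) F =
      lin_ext (\<lambda>b. b \<circ> inv_into UNIV \<sigma>) (lin_ext (\<lambda>b. b \<circ> inv_into UNIV \<tau>) F)"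
    using F(1)[unfolded carrier_free_ring]
    by (rule lin_ext_comp) (simp add: o_inv_distrib permutes_bij[OF \<sigma>] permutes_bij[OF \<tau>] o_assoc)
  moreover have "TI +>\<^bsub>Fr\<^esub> lin_ext (\<lambda>b. b \<circ> inv_into UNIV \<tau>) F \<in> carrier TP"
    using \<tau> F(1) by (intro ring_hom_closed[OF class_hom] lin_ext_perm_closed)
  ultimately show ?thesis
    using t F \<sigma> \<tau>
    by (simp add: perm_Delta_class perm_tensor_class perm_tensor_closed lin_ext_perm_closed
        permutes_compose)
qed

context
  fixes r s :: nat
  assumes le: "r \<le> n" "s \<le> n" and neq: "r \<noteq> s"
begin

lemma transpose_permutes: "transpose r s permutes {0..n}"
  using le by (intro permutes_swap_id) auto

lemmas transpose_hom = perm_tensor_hom[OF transpose_permutes]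
  and transpose_closed [simp] = perm_tensor_closed[OF transpose_permutes]

text \<open>The transposition of \<open>r\<close> and \<open>s\<close> acts trivially modulo \<open>J\<^sub>r\<^sub>s\<close>, because it does so on functions
  restricted to \<open>x\<^sub>r = x\<^sub>s\<close>.\<close>

lemma minus_transpose_in_J:
  assumes "t \<in> carrier TP"
  shows "t \<ominus>\<^bsub>TP\<^esub> perm_tensor n A B g (transpose r s) t \<in> J r s"
proof -
  interpret J: ideal "J r s" TP
    using le by (rule J_ideal)
  let ?\<tau> = "perm_tensor n A B g (transpose r s)" and ?cl = "\<lambda>F. TI +>\<^bsub>Fr\<^esub> F"
  obtain F where F: "F \<in> carrier Fr" "t = ?cl F"
    using assms by (rule tensor_powerE)
  have "?cl F \<ominus>\<^bsub>TP\<^esub> ?\<tau> (?cl F) \<in> J r s"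
    using F(1)[unfolded carrier_free_ring]
  proof (induction rule: tfree_induct)
    case zero
    have "(0 :: 'r tfree) \<in> carrier Fr"
      by (simp add: carrier_free_ring)
    then show ?case
      by (simp add: perm_tensor_class[OF transpose_permutes] ring_hom_closed[OF class_hom]
          TP.minus_eq TP.r_neg)
  next
    case (add F G)
    have F: "?cl F \<in> carrier TP" and G: "?cl G \<in> carrier TP"
      using add by (auto intro!: ring_hom_closed[OF class_hom] simp: carrier_free_ring)
    have "?cl (F + G) = ?cl F \<oplus>\<^bsub>TP\<^esub> ?cl G"
      using add ring_hom_add[OF class_hom, of F G] by (simp add: carrier_free_ring)
    then have "?cl (F + G) \<ominus>\<^bsub>TP\<^esub> ?\<tau> (?cl (F + G)) =
        (?cl F \<ominus>\<^bsub>TP\<^esub> ?\<tau> (?cl F)) \<oplus>\<^bsub>TP\<^esub> (?cl G \<ominus>\<^bsub>TP\<^esub> ?\<tau> (?cl G))"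
      using F G by (simp add: ring_hom_add[OF transpose_hom] TP.minus_eq TP.minus_add TP.a_ac)
    then show ?case
      using add by simp
  next
    case (single b k)
    \<comment> \<open>Split off the factors \<open>r\<close> and \<open>s\<close>; the rest \<open>w\<close>, with the coefficient \<open>k\<close>, is fixed.\<close>
    define w where "w = b(r := \<one>\<^bsub>B\<^esub>, s := \<one>\<^bsub>B\<^esub>)"
    define v where "v = ?cl (Poly_Mapping.single w k)"
    have w: "w \<in> tuples n B"
      unfolding w_def using single le by (intro tuples_upd) auto
    have w_cl: "Poly_Mapping.single w k \<in> carrier Fr"
      using w by (simp add: carrier_free_ring)
    have v: "v \<in> carrier TP"
      unfolding v_def by (rule ring_hom_closed[OF class_hom w_cl])
    have br: "b r \<in> carrier B" and bs: "b s \<in> carrier B"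
      using single le by (auto simp: tuplesD)
    have "w \<circ> transpose r s = w"
      by (auto simp: w_def fun_eq_iff transpose_def)
    then have \<tau>v: "?\<tau> v = v"
      unfolding v_def using w_cl by (simp add: perm_tensor_class[OF transpose_permutes] inv_swap_id)
    let ?e = "\<lambda>i x. (\<lambda>j\<in>{0..n}. \<one>\<^bsub>B\<^esub>)(i := x)"
    have "(\<lambda>i\<in>{0..n}. (\<lambda>i\<in>{0..n}. w i \<otimes>\<^bsub>B\<^esub> ?e r (b r) i) i \<otimes>\<^bsub>B\<^esub> ?e s (b s) i) = b"
      using le neq single tuplesD[OF single]
      by (auto simp: w_def fun_eq_iff tuples_def PiE_iff extensional_def)
    then have "Poly_Mapping.single b k =
        Poly_Mapping.single w k \<otimes>\<^bsub>Fr\<^esub> pure (?e r (b r)) \<otimes>\<^bsub>Fr\<^esub> pure (?e s (b s))"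
      by simp
    then have cl: "?cl (Poly_Mapping.single b k) = v \<otimes>\<^bsub>TP\<^esub> ins' r (b r) \<otimes>\<^bsub>TP\<^esub> ins' s (b s)"
      using w_cl br bs le unfolding v_def ins_def
      by (simp add: ring_hom_mult[OF class_hom, symmetric] pure_closed unit_tuple_upd
          del: mult_free_ring_single)
    have "?cl (Poly_Mapping.single b k) \<ominus>\<^bsub>TP\<^esub> ?\<tau> (?cl (Poly_Mapping.single b k)) =
        v \<otimes>\<^bsub>TP\<^esub> ins' r (b r) \<otimes>\<^bsub>TP\<^esub> ins' s (b s) \<ominus>\<^bsub>TP\<^esub>
        v \<otimes>\<^bsub>TP\<^esub> ins' s (b r) \<otimes>\<^bsub>TP\<^esub> ins' r (b s)"
      using v br bs le unfolding cl
      by (simp add: ring_hom_mult[OF transpose_hom] perm_tensor_ins[OF transpose_permutes] \<tau>v)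
    also have "\<dots> = v \<otimes>\<^bsub>TP\<^esub> (ins' r (b r) \<otimes>\<^bsub>TP\<^esub> d r s (b s) \<ominus>\<^bsub>TP\<^esub>
        ins' r (b s) \<otimes>\<^bsub>TP\<^esub> d r s (b r))"
    proof -
      have "v \<otimes>\<^bsub>TP\<^esub> xr \<otimes>\<^bsub>TP\<^esub> ys \<ominus>\<^bsub>TP\<^esub> v \<otimes>\<^bsub>TP\<^esub> xs \<otimes>\<^bsub>TP\<^esub> yr =
          v \<otimes>\<^bsub>TP\<^esub> (xr \<otimes>\<^bsub>TP\<^esub> (ys \<ominus>\<^bsub>TP\<^esub> yr) \<ominus>\<^bsub>TP\<^esub> yr \<otimes>\<^bsub>TP\<^esub> (xs \<ominus>\<^bsub>TP\<^esub> xr))"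
        if "xr \<in> carrier TP" "xs \<in> carrier TP" "yr \<in> carrier TP" "ys \<in> carrier TP"
        for xr xs yr ys
        using that v by algebra
      then show ?thesis
        unfolding d_elem_def using br bs le by simp
    qed
    also have "\<dots> \<in> J r s"
      using v br bs le unfolding TP.minus_eq
      by (intro J.I_l_closed J.a_closed J.a_inv_closed d_in_J) auto
    finally show ?case .
  qed
  then show ?thesis
    using F(2) by simp
qed

text \<open>The elements \<open>t\<close> of \<open>J\<^sub>r\<^sub>s\<close> with the asserted property form an ideal, thanks to
  \<open>\<tau>(x t) + x t = \<tau>x (\<tau>t + t) + (x - \<tau>x) t\<close>, and it contains the generators of \<open>J\<^sub>r\<^sub>s\<close>.\<close>

lemma transpose_plus_in_J2:
  assumes "t \<in> J r s"
  shows "perm_tensor n A B g (transpose r s) t \<oplus>\<^bsub>TP\<^esub> t \<in> J2"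
proof -
  interpret J: ideal "J r s" TP
    using le by (rule J_ideal)
  let ?\<tau> = "perm_tensor n A B g (transpose r s)"
  interpret \<tau>: ring_hom_ring TP TP ?\<tau>
    using TP.ring_axioms transpose_hom by (intro ring_hom_ringI2)
  let ?K = "{t \<in> J r s. ?\<tau> t \<oplus>\<^bsub>TP\<^esub> t \<in> J2}"
  have mult: "x \<otimes>\<^bsub>TP\<^esub> t \<in> ?K" if t: "t \<in> ?K" and x: "x \<in> carrier TP" for t x
  proof -
    have tc: "t \<in> carrier TP"
      using t by auto
    have "?\<tau> (x \<otimes>\<^bsub>TP\<^esub> t) \<oplus>\<^bsub>TP\<^esub> x \<otimes>\<^bsub>TP\<^esub> t =
        ?\<tau> x \<otimes>\<^bsub>TP\<^esub> (?\<tau> t \<oplus>\<^bsub>TP\<^esub> t) \<oplus>\<^bsub>TP\<^esub> (x \<ominus>\<^bsub>TP\<^esub> ?\<tau> x) \<otimes>\<^bsub>TP\<^esub> t"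
    proof -
      have "y \<otimes>\<^bsub>TP\<^esub> u \<oplus>\<^bsub>TP\<^esub> x \<otimes>\<^bsub>TP\<^esub> t =
          y \<otimes>\<^bsub>TP\<^esub> (u \<oplus>\<^bsub>TP\<^esub> t) \<oplus>\<^bsub>TP\<^esub> (x \<ominus>\<^bsub>TP\<^esub> y) \<otimes>\<^bsub>TP\<^esub> t"
        if "y \<in> carrier TP" "u \<in> carrier TP" for y u
        using that x tc by algebra
      then show ?thesis
        using x tc by (simp add: ring_hom_mult[OF transpose_hom])
    qed
    moreover have "(x \<ominus>\<^bsub>TP\<^esub> ?\<tau> x) \<otimes>\<^bsub>TP\<^esub> t \<in> J2"
      using t minus_transpose_in_J[OF x] J_square_subset_J2[OF le neq]
      by (blast intro: ideal_prod.prod)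
    ultimately show ?thesis
      using t x by (auto intro!: J.I_l_closed J2.I_l_closed J2.a_closed)
  qed
  have "ideal ?K TP"
  proof (rule idealI[OF TP.ring_axioms])
    show "subgroup ?K (add_monoid TP)"
    proof (rule TP.add.subgroupI)
      show "?K \<noteq> {}"
        using J.zero_closed J2.zero_closed by (auto intro!: exI[of _ "\<zero>\<^bsub>TP\<^esub>"])
    next
      fix t assume t: "t \<in> ?K"
      then have "t \<in> carrier TP"
        by auto
      then have "\<ominus>\<^bsub>TP\<^esub> t = (\<ominus>\<^bsub>TP\<^esub> \<one>\<^bsub>TP\<^esub>) \<otimes>\<^bsub>TP\<^esub> t"
        by (simp add: TP.l_minus)
      then show "\<ominus>\<^bsub>TP\<^esub> t \<in> ?K"
        using mult[OF t, of "\<ominus>\<^bsub>TP\<^esub> \<one>\<^bsub>TP\<^esub>"] by simp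
    next
      fix t u assume t: "t \<in> ?K" and u: "u \<in> ?K"
      then have c: "t \<in> carrier TP" "u \<in> carrier TP"
        by auto
      then have "?\<tau> (t \<oplus>\<^bsub>TP\<^esub> u) \<oplus>\<^bsub>TP\<^esub> (t \<oplus>\<^bsub>TP\<^esub> u) =
          (?\<tau> t \<oplus>\<^bsub>TP\<^esub> t) \<oplus>\<^bsub>TP\<^esub> (?\<tau> u \<oplus>\<^bsub>TP\<^esub> u)"
        by (simp add: TP.a_ac)
      then show "t \<oplus>\<^bsub>TP\<^esub> u \<in> ?K"
        using t u by auto
    qed auto
  next
    fix t x assume t: "t \<in> ?K" and x: "x \<in> carrier TP"
    show "x \<otimes>\<^bsub>TP\<^esub> t \<in> ?K"
      using t x by (rule mult)
    then show "t \<otimes>\<^bsub>TP\<^esub> x \<in> ?K"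
      using TP.m_comm[of t x] t x by auto
  qed
  moreover have "d r s ` carrier B \<subseteq> ?K"
    using le
    by (auto simp: perm_tensor_d[OF transpose_permutes] d_swap[of _ r s] TP.l_neg intro!: d_in_J)
  ultimately have "J r s \<subseteq> ?K"
    unfolding J_ideal_def by (rule TP.genideal_minimal)
  then show ?thesis
    using assms by blast
qed

lemma perm_Delta_transpose:
  assumes "f \<in> J_tilde n A B g r s"
  shows "perm_Delta n A B g (transpose r s) f = \<ominus>\<^bsub>\<Delta>\<^esub> f"
proof -
  let ?\<tau> = "perm_tensor n A B g (transpose r s)"
  obtain t where t: "t \<in> J r s" "f = J2 +>\<^bsub>TP\<^esub> t"
    using assms by (auto simp: J_tilde_def)
  have tc: "t \<in> carrier TP"
    using t(1) ideal.Icarr[OF J_ideal[OF le]] by blast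
  have f: "f \<in> carrier \<Delta>"
    using t(2) tc by (simp add: ring_hom_closed[OF Delta_class_hom])
  have "perm_Delta n A B g (transpose r s) f \<oplus>\<^bsub>\<Delta>\<^esub> f = J2 +>\<^bsub>TP\<^esub> (?\<tau> t \<oplus>\<^bsub>TP\<^esub> t)"
    using t(2) tc by (simp add: perm_Delta_class[OF transpose_permutes] ring_hom_add[OF Delta_class_hom])
  also have "\<dots> = \<zero>\<^bsub>\<Delta>\<^esub>"
    using transpose_plus_in_J2[OF t(1)] J2.a_rcos_const by (simp add: Delta_ring_def FactRing_def)
  finally show ?thesis
    using f ring_hom_closed[OF perm_Delta_hom[OF transpose_permutes] f] by (simp add: \<Delta>.minus_equality)
qed

end

lemma Psi_ideal_J_tilde:
  assumes "f \<in> Psi_ideal n A B g" "r \<le> n" "s \<le> n" "r \<noteq> s"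
  shows "f \<in> J_tilde n A B g r s"
proof (cases "r < s")
  case True
  then show ?thesis
    using assms by (simp add: Psi_ideal_def)
next
  case False
  then have "f \<in> J_tilde n A B g s r"
    using assms by (simp add: Psi_ideal_def)
  then show ?thesis
    using J_swap[OF assms(2,3)] by (simp add: J_tilde_def)
qed

lemma perm_Delta_Psi_ideal:
  assumes f: "f \<in> Psi_ideal n A B g" and \<sigma>: "\<sigma> permutes {0..n}"
  shows "perm_Delta n A B g \<sigma> f = (if evenperm \<sigma> then f else \<ominus>\<^bsub>\<Delta>\<^esub> f)"
  using \<sigma> finite_atLeastAtMost
proof (induction rule: permutes_induct)
  case id
  have "f \<in> carrier \<Delta>" "evenperm (id :: nat \<Rightarrow> nat)"
    using f by (simp_all add: Psi_ideal_def)
  then show ?case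
    by (simp only: perm_Delta_id if_True)
next
  case (swap r s p)
  have fc: "f \<in> carrier \<Delta>"
    using f by (simp add: Psi_ideal_def)
  have \<tau>: "transpose r s permutes {0..n}"
    using swap by (intro permutes_swap_id)
  have "perm_Delta n A B g (transpose r s) f = \<ominus>\<^bsub>\<Delta>\<^esub> f"
    using swap f by (intro perm_Delta_transpose Psi_ideal_J_tilde) auto
  moreover have even: "evenperm (transpose r s \<circ> p) \<longleftrightarrow> \<not> evenperm p"
    using swap by (subst evenperm_comp)
      (auto simp: permutation_swap_id evenperm_swap intro: permutes_imp_permutation)
  ultimately show ?case
    unfolding perm_Delta_comp[OF \<tau> \<open>p permutes {0..n}\<close> fc] swap.IH even
    using fc \<tau> by (simp add: perm_Delta_minus)
qed

end

section \<open>Compatible families over the charts\<close>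

context scheme_over
begin

lemma preim_open: "openin (pts S) V \<Longrightarrow> openin (pts X) (preim X \<phi> V)"
  unfolding preim_def by (rule openin_continuous_map_preimage[OF cont])

lemma chartD:
  assumes "c \<in> charts X S \<phi> W"
  shows "openin (pts X) (fst c)" "openin (pts S) (snd c)" "fst c \<subseteq> preim X \<phi> (snd c)"
  using assms openin_subset unfolding charts_def affine_open_def preim_def by fastforce+

lemma structure_hom_closed:
  assumes "c \<in> charts X S \<phi> W" "a \<in> carrier (sec S (snd c))"
  shows "structure_hom X \<phi> c a \<in> carrier (sec X (fst c))"
  using ring_hom_closed[OF comor_hom[OF chartD(2)[OF assms(1)]] assms(2)]
    ring_hom_closed[OF X.res_hom[OF preim_open chartD(1,3)]] chartD(2) assms(1)
  by (simp add: structure_hom_def case_prod_beta)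

lemma chart_tensor_data:
  assumes "c \<in> charts X S \<phi> W"
  shows "tensor_data (sec S (snd c)) (sec X (fst c)) (structure_hom X \<phi> c)"
  by (intro tensor_data.intro X.sec_cring chartD(1)[OF assms] structure_hom_closed[OF assms])

lemma chart_res_hom:
  assumes c: "c \<in> charts X S \<phi> W" and c': "c' \<in> charts X S \<phi> W"
    and le: "fst c' \<subseteq> fst c" "snd c' \<subseteq> snd c"
  shows "chart_res n X S \<phi> c c' \<in> ring_hom (chart_ring n X S \<phi> c) (chart_ring n X S \<phi> c')"
proof -
  interpret src: tensor_data n "sec S (snd c)" "sec X (fst c)" "structure_hom X \<phi> c"
    by (rule chart_tensor_data[OF c])
  interpret tgt: tensor_data n "sec S (snd c')" "sec X (fst c')" "structure_hom X \<phi> c'"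
    by (rule chart_tensor_data[OF c'])
  interpret tensor_map n "sec S (snd c)" "sec X (fst c)" "structure_hom X \<phi> c"
    "sec S (snd c')" "sec X (fst c')" "structure_hom X \<phi> c'"
    "res S (snd c) (snd c')" "res X (fst c) (fst c')" id
    "\<lambda>b. \<lambda>i\<in>{0..n}. res X (fst c) (fst c') (b i)"
  proof unfold_locales
    show "res X (fst c) (fst c') \<in> ring_hom (sec X (fst c)) (sec X (fst c'))"
      using chartD c c' le by (intro X.res_hom)
  next
    fix a assume a: "a \<in> carrier (sec S (snd c))"
    show "res S (snd c) (snd c') a \<in> carrier (sec S (snd c'))"
      using a chartD c c' le by (intro ring_hom_closed[OF S.res_hom])
    let ?V = "preim X \<phi> (snd c)" and ?V' = "preim X \<phi> (snd c')"
    have opn: "openin (pts X) ?V" "openin (pts X) ?V'" "openin (pts X) (fst c)" "openin (pts X) (fst c')"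
      using c c' by (auto intro: preim_open chartD)
    have sub: "fst c \<subseteq> ?V" "fst c' \<subseteq> ?V'" "?V' \<subseteq> ?V"
      using chartD(3)[OF c] chartD(3)[OF c'] le by (auto simp: preim_def)
    have y: "comor \<phi> (snd c) a \<in> carrier (sec X ?V)"
      using a comor_hom[OF chartD(2)[OF c]] by (rule ring_hom_closed[rotated])
    have "res X (fst c) (fst c') (res X ?V (fst c) (comor \<phi> (snd c) a)) =
        res X ?V (fst c') (comor \<phi> (snd c) a)"
      using opn sub le y by (intro X.res_comp) auto
    also have "\<dots> = res X ?V' (fst c') (res X ?V ?V' (comor \<phi> (snd c) a))"
      using opn sub le y by (intro X.res_comp[symmetric]) auto
    also have "\<dots> = res X ?V' (fst c') (comor \<phi> (snd c') (res S (snd c) (snd c') a))"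
      using comor_res[OF chartD(2)[OF c] chartD(2)[OF c'] le(2) a] by simp
    finally show "res X (fst c) (fst c') (structure_hom X \<phi> c a) =
        structure_hom X \<phi> c' (res S (snd c) (snd c') a)"
      by (simp add: structure_hom_def case_prod_beta)
  qed (simp_all add: permutes_id)
  show ?thesis
    using Dmap_hom unfolding Dmap_def tmap_def chart_res_def chart_ring_def chart_tensor_def .
qed

lemma chart_ring_cring:
  assumes "c \<in> charts X S \<phi> W"
  shows "cring (chart_ring n X S \<phi> c)"
proof -
  interpret tensor_data n "sec S (snd c)" "sec X (fst c)" "structure_hom X \<phi> c"
    by (rule chart_tensor_data[OF assms])
  show ?thesis
    unfolding chart_ring_def by (rule \<Delta>.is_cring)
qed

lemma Delta_sheaf_undefined:
  "F \<in> carrier (Delta_sheaf n X S \<phi> W) \<Longrightarrow> c \<notin> charts X S \<phi> W \<Longrightarrow> F c = undefined"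
  unfolding Delta_sheaf_def by (auto dest: PiE_arb)

lemma Delta_sheaf_minus_closed:
  assumes "F \<in> carrier (Delta_sheaf n X S \<phi> W)"
  shows "(\<lambda>c\<in>charts X S \<phi> W. \<ominus>\<^bsub>chart_ring n X S \<phi> c\<^esub> F c) \<in> carrier (Delta_sheaf n X S \<phi> W)"
proof -
  have F: "F c \<in> carrier (chart_ring n X S \<phi> c)" if "c \<in> charts X S \<phi> W" for c
    using assms that by (auto simp: Delta_sheaf_def)
  have "chart_res n X S \<phi> c c' (\<ominus>\<^bsub>chart_ring n X S \<phi> c\<^esub> F c) = \<ominus>\<^bsub>chart_ring n X S \<phi> c'\<^esub> F c'"
    if c: "c \<in> charts X S \<phi> W" and c': "c' \<in> charts X S \<phi> W"
      and le: "fst c' \<subseteq> fst c" "snd c' \<subseteq> snd c" for c c'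
  proof -
    interpret ring_hom_ring "chart_ring n X S \<phi> c" "chart_ring n X S \<phi> c'" "chart_res n X S \<phi> c c'"
      using chart_ring_cring c c' chart_res_hom[OF c c' le]
      by (intro ring_hom_ringI2 cring.axioms(1))
    have "chart_res n X S \<phi> c c' (F c) = F c'"
      using assms c c' le by (auto simp: Delta_sheaf_def)
    then show ?thesis
      using F[OF c] by simp
  qed
  moreover have "\<ominus>\<^bsub>chart_ring n X S \<phi> c\<^esub> F c \<in> carrier (chart_ring n X S \<phi> c)"
    if c: "c \<in> charts X S \<phi> W" for c
  proof -
    interpret cring "chart_ring n X S \<phi> c"
      using c by (rule chart_ring_cring)
    show ?thesis
      using F[OF c] by simp
  qed
  ultimately show ?thesis
    by (simp add: Delta_sheaf_def)
qed

lemma Delta_sheaf_zero_add: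
  assumes "F \<in> carrier (Delta_sheaf n X S \<phi> W)"
  shows "\<zero>\<^bsub>Delta_sheaf n X S \<phi> W\<^esub> \<oplus>\<^bsub>Delta_sheaf n X S \<phi> W\<^esub> F = F"
proof
  fix c
  show "(\<zero>\<^bsub>Delta_sheaf n X S \<phi> W\<^esub> \<oplus>\<^bsub>Delta_sheaf n X S \<phi> W\<^esub> F) c = F c"
  proof (cases "c \<in> charts X S \<phi> W")
    case True
    then interpret cring "chart_ring n X S \<phi> c"
      by (rule chart_ring_cring)
    have "F c \<in> carrier (chart_ring n X S \<phi> c)"
      using assms True by (auto simp: Delta_sheaf_def)
    then show ?thesis
      using True by (simp add: Delta_sheaf_def)
  next
    case False
    then show ?thesis
      using Delta_sheaf_undefined[OF assms] by (simp add: Delta_sheaf_def)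
  qed
qed

text \<open>The inverse is the description of the unique element with the cancelling property, so both its
  existence among the compatible families and its uniqueness there are needed.\<close>

lemma Delta_sheaf_add_inverse:
  assumes F: "F \<in> carrier (Delta_sheaf n X S \<phi> W)"
  shows "m_inv (add_monoid (Delta_sheaf n X S \<phi> W)) F =
    (\<lambda>c\<in>charts X S \<phi> W. \<ominus>\<^bsub>chart_ring n X S \<phi> c\<^esub> F c)"
  (is "_ = ?N")
proof -
  let ?D = "Delta_sheaf n X S \<phi> W" and ?C = "charts X S \<phi> W"
  have closed: "G c \<in> carrier (chart_ring n X S \<phi> c)" if "G \<in> carrier ?D" "c \<in> ?C" for G c
    using that by (auto simp: Delta_sheaf_def)
  show ?thesis
    unfolding m_inv_def
  proof (rule the_equality)
    have "F c \<oplus>\<^bsub>chart_ring n X S \<phi> c\<^esub> (\<ominus>\<^bsub>chart_ring n X S \<phi> c\<^esub> F c) = \<zero>\<^bsub>chart_ring n X S \<phi> c\<^esub> \<and>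
        (\<ominus>\<^bsub>chart_ring n X S \<phi> c\<^esub> F c) \<oplus>\<^bsub>chart_ring n X S \<phi> c\<^esub> F c = \<zero>\<^bsub>chart_ring n X S \<phi> c\<^esub>"
      if c: "c \<in> ?C" for c
    proof -
      interpret cring "chart_ring n X S \<phi> c"
        using c by (rule chart_ring_cring)
      show ?thesis
        using closed[OF F c] by (simp add: l_neg r_neg)
    qed
    then have "F \<oplus>\<^bsub>?D\<^esub> ?N = \<zero>\<^bsub>?D\<^esub>" "?N \<oplus>\<^bsub>?D\<^esub> F = \<zero>\<^bsub>?D\<^esub>"
      by (auto simp: Delta_sheaf_def fun_eq_iff)
    then show "?N \<in> carrier (add_monoid ?D) \<and>
        F \<otimes>\<^bsub>add_monoid ?D\<^esub> ?N = \<one>\<^bsub>add_monoid ?D\<^esub> \<and> ?N \<otimes>\<^bsub>add_monoid ?D\<^esub> F = \<one>\<^bsub>add_monoid ?D\<^esub>"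
      using Delta_sheaf_minus_closed[OF F] by simp
  next
    fix G
    assume "G \<in> carrier (add_monoid ?D) \<and>
        F \<otimes>\<^bsub>add_monoid ?D\<^esub> G = \<one>\<^bsub>add_monoid ?D\<^esub> \<and> G \<otimes>\<^bsub>add_monoid ?D\<^esub> F = \<one>\<^bsub>add_monoid ?D\<^esub>"
    then have G: "G \<in> carrier ?D" and eq: "G \<oplus>\<^bsub>?D\<^esub> F = \<zero>\<^bsub>?D\<^esub>"
      by simp_all
    show "G = ?N"
    proof
      fix c
      show "G c = ?N c"
      proof (cases "c \<in> ?C")
        case True
        then interpret cring "chart_ring n X S \<phi> c"
          by (rule chart_ring_cring)
        have "G c \<oplus>\<^bsub>chart_ring n X S \<phi> c\<^esub> F c = \<zero>\<^bsub>chart_ring n X S \<phi> c\<^esub>"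
          using fun_cong[OF eq, of c] True by (simp add: Delta_sheaf_def)
        then show ?thesis
          using closed[OF F True] closed[OF G True] True by (simp add: minus_equality)
      next
        case False
        then show ?thesis
          using Delta_sheaf_undefined[OF G] by simp
      qed
    qed
  qed
qed

lemma Delta_sheaf_add_pow_sign:
  assumes "F \<in> carrier (Delta_sheaf n X S \<phi> W)"
  shows "[sign \<sigma>] \<cdot>\<^bsub>Delta_sheaf n X S \<phi> W\<^esub> F =
    (if evenperm \<sigma> then F else (\<lambda>c\<in>charts X S \<phi> W. \<ominus>\<^bsub>chart_ring n X S \<phi> c\<^esub> F c))"
  using Delta_sheaf_zero_add[OF assms] Delta_sheaf_add_inverse[OF assms]
  by (simp add: sign_def add_pow_def int_pow_def)

end

theorem proposition1p12:
  fixes X :: "('x, 'r) ringed_space" and S :: "('s, 'a) ringed_space"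
    and \<phi> :: "('x, 'r, 's, 'a) space_map" and n :: nat and W :: "'x set"
    and \<sigma> :: "nat \<Rightarrow> nat" and f :: "'x set \<times> 's set \<Rightarrow> 'r tfree set set"
  assumes "scheme_over X S \<phi>"
    and "n \<ge> 1"
    and "openin (pts X) W"
    and "\<sigma> permutes {0..n}"
    and "f \<in> Psi_sheaf n X S \<phi> W"
  shows "perm_action n X S \<phi> W \<sigma> f = [sign \<sigma>] \<cdot>\<^bsub>Delta_sheaf n X S \<phi> W\<^esub> f"
proof -
  interpret scheme_over X S \<phi> by fact
  have f: "f \<in> carrier (Delta_sheaf n X S \<phi> W)"
    and Psi: "\<And>c. c \<in> charts X S \<phi> W \<Longrightarrow> f c \<in> chart_Psi n X S \<phi> c"
    using assms(5) by (auto simp: Psi_sheaf_def)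
  have chart: "chart_perm n X S \<phi> \<sigma> c (f c) =
      (if evenperm \<sigma> then f c else \<ominus>\<^bsub>chart_ring n X S \<phi> c\<^esub> f c)" if "c \<in> charts X S \<phi> W" for c
    using tensor_data.perm_Delta_Psi_ideal[OF chart_tensor_data[OF that] _ assms(4)] Psi[OF that]
    unfolding chart_Psi_def chart_perm_def chart_ring_def by blast
  show ?thesis
    unfolding Delta_sheaf_add_pow_sign[OF f] perm_action_def
    using chart Delta_sheaf_undefined[OF f] by (auto simp: fun_eq_iff)
qed

end
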